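(* Let $d'\geq 2$, $t\geq 2$ and $n\geq 3$ be integers with $t\mid d'$, and let $A_1,\ldots,A_n$ be $n$ nontrivial partitions of $2d'$ of the form $$A_1=[2a_{11},\ldots,2a_{1r_1}],\quad A_2=[2a_{21},\ldots,2a_{2r_2}],\quad A_3=[ta_{31},\ldots,ta_{3r_3}],$$ $$A_k=[a_{k1},\ldots,a_{kr_k}]\quad (4\leq k\leq n),$$ where all $a_{kl}\geq 1$ are integers, satisfying $\sum_{k=1}^{n}r_k=2(n-2)d'+2$. Suppose that there exists a branched cover $f:S^2\to S^2$ of degree $2d'$ with branching data $\{A_1,\ldots,A_n\}$. Then: (1) $a_{ij}\leq d'/t$ for all $1\leq i\leq n$ and $1\leq j\leq r_i$; (2) if $n\geq 4$, each partition $A_i$ with $4\leq i\leq n$ has length $r_i>2t$.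
   Context: A branched cover $f:Y\to X$ between compact, connected, orientable surfaces is a surjective map that is locally modeled on the power maps $\mathbb{C}\ni z\mapsto z^m\in\mathbb{C}$ for positive integers $m$; $m$ is the local degree at the preimage point corresponding to $0$. A point of $X$ having a preimage of local degree greater than $1$ is a branch point; there are finitely many of them. Removing the branch points and their preimages gives a genuine covering map, whose degree $d$ is called the degree of $f$. A partition of $d$ is a multiset $[b_1,\ldots,b_r]$ of positive integers with sum $d$; its length is $r$, and it is nontrivial if at least one part is greater than $1$. The local degrees at the preimages of each branch point form a nontrivial partition of $d$. If $f$ has $n$ branch points, with corresponding partitions $A_1,\ldots,A_n$, then $\{A_1,\ldots,A_n\}$ (counted with multiplicity) is the branching data of $f$. *)

theory Defs
  imports "HOL-Analysis.Analysis" "HOL-Library.Multiset"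
begin

abbreviation S2 :: "(real^3) set" where
  "S2 \<equiv> sphere 0 1"

(* Maps between surfaces are total functions of which only the values on the
   source set Y matter.  The chart domains are homeomorphic to the whole complex
   plane, and no compatibility with orientations is required. *)
definition has_local_degree ::
  "'a::topological_space set \<Rightarrow> 'b::topological_space set \<Rightarrow> ('a \<Rightarrow> 'b) \<Rightarrow> 'a \<Rightarrow> nat \<Rightarrow> bool" where
  "has_local_degree Y X f y m \<longleftrightarrow>
     m \<ge> 1 \<and>
     (\<exists>U V \<phi> \<phi>' \<psi> \<psi>'.
        openin (top_of_set Y) U \<and> y \<in> U \<and>
        openin (top_of_set X) V \<and> f ` U \<subseteq> V \<and>
        homeomorphism U (UNIV :: complex set) \<phi> \<phi>' \<and> \<phi> y = 0 \<and>
        homeomorphism V (UNIV :: complex set) \<psi> \<psi>' \<and> \<psi> (f y) = 0 \<and>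
        (\<forall>u\<in>U. \<psi> (f u) = \<phi> u ^ m))"

(* The sets Y and X are meant to be compact, connected, orientable surfaces.
   Continuity of f on Y follows from the local models. *)
definition branched_cover ::
  "'a::topological_space set \<Rightarrow> 'b::topological_space set \<Rightarrow> ('a \<Rightarrow> 'b) \<Rightarrow> bool" where
  "branched_cover Y X f \<longleftrightarrow> f ` Y = X \<and> (\<forall>y\<in>Y. \<exists>m. has_local_degree Y X f y m)"

definition local_degree ::
  "'a::topological_space set \<Rightarrow> 'b::topological_space set \<Rightarrow> ('a \<Rightarrow> 'b) \<Rightarrow> 'a \<Rightarrow> nat" where
  "local_degree Y X f y = (THE m. has_local_degree Y X f y m)"

definition branch_points ::
  "'a::topological_space set \<Rightarrow> 'b::topological_space set \<Rightarrow> ('a \<Rightarrow> 'b) \<Rightarrow> 'b set" where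
  "branch_points Y X f = {x \<in> X. \<exists>y\<in>Y. f y = x \<and> local_degree Y X f y > 1}"

(* The covering map over the complement of the branch points is d-sheeted. *)
definition has_cover_degree ::
  "'a::topological_space set \<Rightarrow> 'b::topological_space set \<Rightarrow> ('a \<Rightarrow> 'b) \<Rightarrow> nat \<Rightarrow> bool" where
  "has_cover_degree Y X f d \<longleftrightarrow>
     (\<forall>x \<in> X - branch_points Y X f. finite {y \<in> Y. f y = x} \<and> card {y \<in> Y. f y = x} = d)"

(* A multiset built with mset_set is empty when the underlying set is infinite.
   This does not occur for a branched cover of a compact Y: its fibres and its
   set of branch points are finite. *)
definition fibre_partition ::
  "'a::topological_space set \<Rightarrow> 'b::topological_space set \<Rightarrow> ('a \<Rightarrow> 'b) \<Rightarrow> 'b \<Rightarrow> nat multiset" where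
  "fibre_partition Y X f x = {# local_degree Y X f y. y \<in># mset_set {y \<in> Y. f y = x} #}"

definition branching_data ::
  "'a::topological_space set \<Rightarrow> 'b::topological_space set \<Rightarrow> ('a \<Rightarrow> 'b) \<Rightarrow> nat multiset multiset" where
  "branching_data Y X f = {# fibre_partition Y X f x. x \<in># mset_set (branch_points Y X f) #}"

definition is_partition :: "nat \<Rightarrow> nat multiset \<Rightarrow> bool" where
  "is_partition d A \<longleftrightarrow> (\<forall>b\<in>#A. b \<ge> 1) \<and> sum_mset A = d"

definition nontrivial_partition :: "nat \<Rightarrow> nat multiset \<Rightarrow> bool" where
  "nontrivial_partition d A \<longleftrightarrow> is_partition d A \<and> (\<exists>b\<in>#A. b > 1)"

end

theory Submission
  imports Defs
begin

text \<open>
  Let \<open>x1\<close>, \<open>x2\<close>, \<open>x3\<close> be the branch points that carry \<open>A 1\<close>, \<open>A 2\<close>, \<open>A 3\<close>, and let \<open>\<sigma>\<close> be a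
  coordinate on the sphere with \<open>\<sigma> x1 = 1\<close>, \<open>\<sigma> x2 = - 1\<close>, \<open>\<sigma> x3 = \<infinity>\<close>.  The rational function
  \<open>\<Phi> w = (w ^ t + 1 / w ^ t) / 2\<close> of degree \<open>2 * t\<close> is the quotient of the sphere by a dihedral
  group of order \<open>2 * t\<close>: all its local degrees are \<open>2\<close> over \<open>1\<close> and \<open>- 1\<close>, they are \<open>t\<close> over
  \<open>\<infinity>\<close>, and \<open>1\<close> elsewhere.  The local degrees of \<open>f\<close> over \<open>x1\<close>, \<open>x2\<close> are even and those over
  \<open>x3\<close> are multiples of \<open>t\<close>, so \<open>f\<close> factors through \<open>\<Phi>\<close>: there is a map \<open>u\<close> with
  \<open>\<sigma> (f y) = \<Phi> (u y)\<close> away from the fibre over \<open>x3\<close>.  It has degree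
  \<open>N = 2 * d' / (2 * t) = d' / t\<close>.  Near a point \<open>y\<close> of local
  degree \<open>m\<close>, a generic value of \<open>f\<close> is taken \<open>m\<close> times, and there \<open>u\<close> distributes these \<open>m\<close>
  points over at most \<open>l\<close> values, where \<open>l\<close> is the local degree of \<open>\<Phi>\<close> at the image of \<open>y\<close>.
  Each generic value of \<open>u\<close> is taken exactly \<open>N\<close> times, hence \<open>m \<le> l * N\<close>
  (\<open>local_degree_bound\<close>).  Since \<open>m\<close> is \<open>2 * a 1 j\<close>, \<open>2 * a 2 j\<close>, \<open>t * a 3 j\<close> or \<open>a i j\<close>
  with \<open>l\<close> equal to \<open>2\<close>, \<open>2\<close>, \<open>t\<close> or \<open>1\<close>, this is the first claim.

  The factorization is made of two extractions of roots, because
  \<open>(q + 1 / q) / 2 = Z\<close> says that \<open>q = Z + v\<close> with \<open>v\<^sup>2 = Z\<^sup>2 - 1\<close>: first a square root \<open>v\<close> of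
  \<open>Z\<^sup>2 - 1\<close> for \<open>Z = \<sigma> \<circ> f\<close>, then a \<open>t\<close>-th root \<open>u\<close> of \<open>q = Z + v\<close>.  The functions \<open>Z\<^sup>2 - 1\<close> and
  \<open>q\<close> are nonzero and continuous away from finitely many points of the sphere.  Simple
  connectedness enters in the following form: a continuous nowhere vanishing function on the complement of a finite set has a
  \<open>t\<close>-th root as soon as it has one near each of the omitted points
  (\<open>continuous_root_on_S2_minus_finite\<close>).  Near a point of local degree divisible by \<open>t\<close> the map
  \<open>f\<close> is a \<open>t\<close>-th power in charts, and \<open>H (w ^ t)\<close> always has a \<open>t\<close>-th root on a punctured disc,
  as \<open>H\<close> winds an integral number of times around \<open>0\<close> (\<open>continuous_root_of_comp_power\<close>).

  The second claim follows from the first one and the count of the lengths.  The parts being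
  multiples of \<open>2\<close>, \<open>2\<close> and \<open>t\<close>, the first three partitions have lengths at most
  \<open>d'\<close>, \<open>d'\<close> and \<open>2 * N\<close>, and all others have lengths at most \<open>2 * d'\<close>;
  then the formula for the sum of all lengths gives
  \<open>r i \<ge> 2 * (t * N) + 2 - 2 * N\<close>.  This exceeds \<open>2 * t\<close> if \<open>N \<ge> 2\<close>, and \<open>N = 1\<close> would force all
  parts of the nontrivial partition \<open>A i\<close> to be \<open>1\<close>.
\<close>

section \<open>Roots of functions on punctured planes and spheres\<close>

text \<open>
  The function \<open>H \<circ> exp\<close> has a logarithm \<open>L\<close> on a half plane, and \<open>L\<close> changes by a constant
  \<open>c \<in> 2 * pi * \<i> * \<int>\<close> under the translation by \<open>2 * pi * \<i>\<close>.  Therefore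
  \<open>\<zeta> \<mapsto> exp (L (t * \<zeta>) / t)\<close> changes by the factor \<open>exp (t * c / t) = 1\<close>, and so it is a function
  of \<open>w = exp \<zeta>\<close>; its \<open>t\<close>-th power is \<open>H (w ^ t)\<close>.
\<close>
lemma continuous_root_of_comp_power:
  fixes H :: "complex \<Rightarrow> complex"
  assumes t: "t \<ge> 1"
    and contH: "continuous_on (ball 0 R - {0}) H"
    and H0: "\<And>w. w \<in> ball 0 R - {0} \<Longrightarrow> H w \<noteq> 0"
  obtains S where "continuous_on {w. w \<noteq> 0 \<and> w ^ t \<in> ball 0 R} S"
    and "\<And>w. w \<noteq> 0 \<Longrightarrow> w ^ t \<in> ball 0 R \<Longrightarrow> S w ^ t = H (w ^ t)"
proof -
  define A where "A = {\<zeta>::complex. exp (Re \<zeta>) < R}"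
  have memA: "\<zeta> \<in> A \<longleftrightarrow> exp \<zeta> \<in> ball 0 R - {0}" for \<zeta>
    by (simp add: A_def)
  have conv: "convex A"
  proof (cases "R > 0")
    case True
    have "exp x < R \<longleftrightarrow> x < ln R" for x :: real
      using True by (metis exp_less_cancel_iff exp_ln)
    then have "A = {z. Re z < ln R}" by (simp add: A_def)
    then show ?thesis by (simp add: convex_halfspace_Re_lt)
  next
    case False
    have "A = {}" using False by (auto simp: A_def) (meson exp_gt_zero less_trans not_less_iff_gr_or_eq)
    then show ?thesis by simp
  qed
  have "continuous_on A (\<lambda>\<zeta>. H (exp \<zeta>))"
    by (intro continuous_on_compose2[OF contH] continuous_intros) (use memA in auto)
  then obtain L where contL: "continuous_on A L" and L: "\<And>\<zeta>. \<zeta> \<in> A \<Longrightarrow> H (exp \<zeta>) = exp (L \<zeta>)"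
    using continuous_logarithm_on_contractible[OF _ convex_imp_contractible[OF conv]] memA H0 by metis
  define p where "p = 2 * complex_of_real pi * \<i>"
  have Ap: "\<zeta> + of_nat k * p \<in> A \<longleftrightarrow> \<zeta> \<in> A" for \<zeta> k
    by (simp add: A_def p_def)
  have expp: "exp (\<zeta> + of_nat k * p) = exp \<zeta>" for \<zeta> k
    by (simp add: p_def exp_add exp_of_nat_mult)
  have period: "\<exists>c. exp c = 1 \<and> (\<forall>\<zeta>\<in>A. L (\<zeta> + p) = L \<zeta> + c)"
  proof -
    define g where "g = (\<lambda>\<zeta>. L (\<zeta> + p) - L \<zeta>)"
    have eg: "exp (g \<zeta>) = 1" if "\<zeta> \<in> A" for \<zeta>
      using L[of "\<zeta> + p"] L[of \<zeta>] that Ap[of \<zeta> 1] expp[of \<zeta> 1]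
      by (simp add: g_def exp_diff)
    have "g constant_on A"
    proof (rule continuous_discrete_range_constant)
      show "connected A" using conv by (rule convex_connected)
      show "continuous_on A g" unfolding g_def
        by (intro continuous_intros continuous_on_compose2[OF contL]) (use Ap[of _ 1] contL in auto)
      fix x assume x: "x \<in> A"
      show "\<exists>e>0. \<forall>y. y \<in> A \<and> g y \<noteq> g x \<longrightarrow> e \<le> cmod (g y - g x)"
      proof (intro exI[of _ "2 * pi"] conjI allI impI)
        fix y assume y: "y \<in> A \<and> g y \<noteq> g x"
        have "exp (g y - g x) = 1" using eg x y by (simp add: exp_diff)
        then obtain n :: int where n: "Re (g y - g x) = 0" "Im (g y - g x) = of_int (2 * n) * pi"
          by (auto simp: exp_eq_1)
        have "n \<noteq> 0"
          using n y by (auto simp: complex_eq_iff)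
        then have "\<bar>real_of_int n\<bar> \<ge> 1" by linarith
        then have "2 * pi \<le> \<bar>Im (g y - g x)\<bar>"
          using n pi_gt_zero by (simp add: abs_mult)
        then show "2 * pi \<le> cmod (g y - g x)" using abs_Im_le_cmod order_trans by blast
      qed simp
    qed
    then obtain c where c: "\<And>\<zeta>. \<zeta> \<in> A \<Longrightarrow> g \<zeta> = c" by (auto simp: constant_on_def)
    show ?thesis
    proof (cases "A = {}")
      case True then show ?thesis by (intro exI[of _ 0]) simp
    next
      case False
      then show ?thesis using c eg by (intro exI[of _ c]) (force simp: g_def algebra_simps)
    qed
  qed
  then obtain c where c: "exp c = 1" "\<And>\<zeta>. \<zeta> \<in> A \<Longrightarrow> L (\<zeta> + p) = L \<zeta> + c" by blast
  have cn: "L (\<zeta> + of_nat k * p) = L \<zeta> + of_nat k * c" if "\<zeta> \<in> A" for \<zeta> k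
  proof (induction k)
    case (Suc k)
    have "\<zeta> + of_nat (Suc k) * p = (\<zeta> + of_nat k * p) + p" by (simp add: algebra_simps)
    then have "L (\<zeta> + of_nat (Suc k) * p) = L (\<zeta> + of_nat k * p) + c" using c(2) Ap that by metis
    then show ?case using Suc by (simp add: algebra_simps)
  qed simp
  define D where "D = {w::complex. w \<noteq> 0 \<and> w ^ t \<in> ball 0 R}"
  define K where "K = (\<lambda>\<zeta>. exp (L (of_nat t * \<zeta>) / of_nat t))"
  have tA: "of_nat t * \<zeta> \<in> A" if "exp \<zeta> \<in> D" for \<zeta>
    using that by (simp add: memA D_def exp_of_nat_mult)
  have Kper: "K (\<zeta> + p) = K \<zeta>" if "exp \<zeta> \<in> D" for \<zeta>
  proof -
    have "of_nat t * (\<zeta> + p) = of_nat t * \<zeta> + of_nat t * p" by (simp add: algebra_simps)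
    then have "L (of_nat t * (\<zeta> + p)) = L (of_nat t * \<zeta>) + of_nat t * c"
      using cn[OF tA[OF that]] by simp
    then show ?thesis using t c(1) by (simp add: K_def add_divide_distrib exp_add)
  qed
  have Kpow: "K \<zeta> ^ t = H (exp \<zeta> ^ t)" if "exp \<zeta> \<in> D" for \<zeta>
  proof -
    have "K \<zeta> ^ t = exp (L (of_nat t * \<zeta>))"
      using t by (simp add: K_def flip: exp_of_nat_mult)
    then show ?thesis using L[OF tA[OF that]] by (simp add: exp_of_nat_mult)
  qed
  define S where "S = (\<lambda>w. K (Ln w))"
  have S2: "S w = K (Ln (- w) + \<i> * pi)" if w: "w \<in> D" for w
  proof -
    have w0: "w \<noteq> 0" using w by (simp add: D_def)
    have e: "exp (Ln (- w) + \<i> * pi) = w" using w0 by (simp add: exp_add)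
    have "Ln w = Ln (-w) + \<i> * pi \<or> Ln w + p = Ln (-w) + \<i> * pi"
      using Ln_minus[of "- w"] w0 by (auto simp: p_def split: if_splits)
    then show ?thesis
      using Kper[of "Ln w"] w w0 by (auto simp: S_def)
  qed
  have contK: "continuous_on {\<zeta>. exp \<zeta> \<in> D} K"
    unfolding K_def by (intro continuous_intros continuous_on_compose2[OF contL]) (use tA t in auto)
  have openD: "open D"
  proof -
    have "D = - {0} \<inter> (\<lambda>w. w ^ t) -` ball 0 R" by (auto simp: D_def)
    then show ?thesis by (auto intro!: open_Int open_vimage continuous_intros)
  qed
  \<comment> \<open>By periodicity of \<open>K\<close> the principal branch of the logarithm may be replaced by one that is
    continuous across the negative axis; the two branches together give continuity on all of \<open>D\<close>.\<close>
  have c1: "continuous_on (D - \<real>\<^sub>\<le>\<^sub>0) S"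
    unfolding S_def by (intro continuous_on_compose2[OF contK] continuous_intros) (auto simp: D_def)
  have "continuous_on (D - \<real>\<^sub>\<ge>\<^sub>0) (\<lambda>w. K (Ln (- w) + \<i> * pi))"
  proof (intro continuous_on_compose2[OF contK] continuous_intros)
    show "(\<lambda>w. Ln (- w) + \<i> * complex_of_real pi) ` (D - \<real>\<^sub>\<ge>\<^sub>0) \<subseteq> {\<zeta>. exp \<zeta> \<in> D}"
      by (auto simp: D_def exp_add)
  qed (auto simp: complex_nonneg_Reals_iff complex_nonpos_Reals_iff)
  then have c2: "continuous_on (D - \<real>\<^sub>\<ge>\<^sub>0) S"
    by (rule continuous_on_eq) (simp add: S2)
  have "continuous_on ((D - \<real>\<^sub>\<le>\<^sub>0) \<union> (D - \<real>\<^sub>\<ge>\<^sub>0)) S"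
    by (rule continuous_on_open_Un[OF _ _ c1 c2]) (use openD in \<open>auto intro!: open_Diff\<close>)
  also have "(D - \<real>\<^sub>\<le>\<^sub>0) \<union> (D - \<real>\<^sub>\<ge>\<^sub>0) = D"
    by (auto simp: D_def complex_nonneg_Reals_iff complex_nonpos_Reals_iff complex_eq_iff)
  finally have "continuous_on D S" .
  moreover have "S w ^ t = H (w ^ t)" if "w \<in> D" for w
    using Kpow[of "Ln w"] that by (auto simp: S_def D_def)
  ultimately show ?thesis using that[of S] by (auto simp: D_def)
qed

text \<open>
  The points are filled in one at a time.  A root \<open>s\<close> of \<open>F\<close> near \<open>p\<close> extends, by composition with
  the radial retraction \<open>\<rho>\<close> onto a small punctured disc, to a nowhere vanishing function \<open>E\<close> on the
  plane without \<open>p\<close>.  The quotient \<open>F / E ^ t\<close> is \<open>1\<close> near \<open>p\<close>, hence extends continuously over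
  \<open>p\<close>, and a root of it times \<open>E\<close> is a root of \<open>F\<close>.  When no point is left, the plane is
  contractible and there is even a logarithm.
\<close>
lemma continuous_root_on_finite_complement:
  fixes F :: "complex \<Rightarrow> complex"
  assumes "finite P" and t: "t \<ge> 1"
    and "continuous_on (- P) F" and "\<And>z. z \<notin> P \<Longrightarrow> F z \<noteq> 0"
    and "\<And>p. p \<in> P \<Longrightarrow> \<exists>U s. open U \<and> p \<in> U \<and> continuous_on (U - P) s \<and> (\<forall>z\<in>U - P. s z ^ t = F z)"
  shows "\<exists>s. continuous_on (- P) s \<and> (\<forall>z\<in>- P. s z ^ t = F z)"
  using assms(1,3-)
proof (induction P arbitrary: F rule: finite_induct)
  case empty
  obtain g where g: "continuous_on UNIV g" "\<And>z. F z = exp (g z)"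
    using continuous_logarithm_on_contractible[of UNIV F] empty by (auto simp: convex_imp_contractible)
  show ?case
    by (rule exI[of _ "\<lambda>z. exp (g z / of_nat t)"])
       (use t g in \<open>auto intro!: continuous_intros simp flip: exp_of_nat_mult\<close>)
next
  case (insert p P)
  obtain U s where U: "open U" "p \<in> U" and s: "continuous_on (U - insert p P) s"
    "\<And>z. z \<in> U - insert p P \<Longrightarrow> s z ^ t = F z"
    using insert.prems(3)[of p] by auto
  have "open (U - P)" "p \<in> U - P" using U insert.hyps by (auto simp: finite_imp_closed open_Diff)
  then obtain d where d: "d > 0" "cball p d \<subseteq> U - P" by (meson open_contains_cball)
  define \<rho> where "\<rho> = (\<lambda>z. p + complex_of_real (min 1 (d / norm (z - p))) * (z - p))"
  have \<rho>id: "\<rho> z = z" if "z \<in> cball p d" "z \<noteq> p" for z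
  proof -
    have "d / norm (z - p) \<ge> 1" using that by (simp add: dist_norm norm_minus_commute)
    then have "min 1 (d / norm (z - p)) = 1" by simp
    then show ?thesis by (simp add: \<rho>_def)
  qed
  have \<rho>im: "\<rho> z \<in> U - insert p P" if "z \<noteq> p" for z
  proof -
    have "dist p (\<rho> z) = min 1 (d / norm (z - p)) * norm (z - p)"
      using that d(1) by (simp add: \<rho>_def dist_norm norm_mult)
    also have "\<dots> \<le> d / norm (z - p) * norm (z - p)" by (intro mult_right_mono) auto
    also have "\<dots> = d" using that by simp
    finally have "\<rho> z \<in> cball p d" by simp
    moreover have "min 1 (d / norm (z - p)) > 0" using d(1) that by simp
    then have "\<rho> z \<noteq> p" using that unfolding \<rho>_def
      by (metis add_cancel_left_right mult_eq_0_iff of_real_eq_0_iff order_less_irrefl right_minus_eq)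
    ultimately show ?thesis using d(2) by auto
  qed
  have cont\<rho>: "continuous_on (- {p}) \<rho>"
    unfolding \<rho>_def by (intro continuous_intros) auto
  define E where "E = (\<lambda>z. s (\<rho> z))"
  have contE: "continuous_on (- {p}) E"
    unfolding E_def by (intro continuous_on_compose2[OF s(1) cont\<rho>]) (use \<rho>im in auto)
  have E0: "E z \<noteq> 0" if "z \<noteq> p" for z
    using s(2)[OF \<rho>im[OF that]] insert.prems(2)[of "\<rho> z"] \<rho>im[OF that] t by (auto simp: E_def zero_power)
  define F1 where "F1 = (\<lambda>z. if z = p then 1 else F z / E z ^ t)"
  have F1p: "F1 z = 1" if "z \<in> ball p d" for z
  proof (cases "z = p")
    case False
    then have "z \<in> cball p d" using that by simp
    then have "E z = s z" "z \<in> U - insert p P" using \<rho>id[OF _ False] False d(2) by (auto simp: E_def)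
    then show ?thesis using s(2)[of z] insert.prems(2)[of z] False by (simp add: F1_def)
  qed (simp add: F1_def)
  have "\<exists>s1. continuous_on (- P) s1 \<and> (\<forall>z\<in>- P. s1 z ^ t = F1 z)"
  proof (rule insert.IH)
    have "continuous_on (ball p d \<union> - insert p P) F1"
    proof (rule continuous_on_open_Un)
      show "continuous_on (ball p d) F1"
        by (rule continuous_on_eq[OF continuous_on_const[of _ 1]]) (use F1p in simp)
      have "continuous_on (- insert p P) (\<lambda>z. F z / E z ^ t)"
        by (intro continuous_intros insert.prems(1) continuous_on_subset[OF contE]) (use E0 in auto)
      then show "continuous_on (- insert p P) F1"
        by (rule continuous_on_eq) (simp add: F1_def)
    qed (use insert.hyps in \<open>auto simp: finite_imp_closed open_Compl\<close>)
    then show "continuous_on (- P) F1"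
      by (rule continuous_on_subset) (use d in auto)
    show "F1 z \<noteq> 0" if "z \<notin> P" for z
      using E0 insert.prems(2) that by (auto simp: F1_def)
    fix p' assume p': "p' \<in> P"
    then obtain U' s' where U': "open U'" "p' \<in> U'" and s': "continuous_on (U' - insert p P) s'"
      "\<And>z. z \<in> U' - insert p P \<Longrightarrow> s' z ^ t = F z"
      using insert.prems(3)[of p'] by auto
    show "\<exists>U s. open U \<and> p' \<in> U \<and> continuous_on (U - P) s \<and> (\<forall>z\<in>U - P. s z ^ t = F1 z)"
    proof (intro exI[of _ "U' - {p}"] exI[of _ "\<lambda>z. s' z / E z"] conjI)
      show "continuous_on (U' - {p} - P) (\<lambda>z. s' z / E z)"
        by (intro continuous_intros continuous_on_subset[OF contE] continuous_on_subset[OF s'(1)])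
           (use E0 in auto)
    qed (use U' s' p' insert.hyps in \<open>auto simp: F1_def power_divide\<close>)
  qed
  then obtain s1 where s1: "continuous_on (- P) s1" "\<And>z. z \<notin> P \<Longrightarrow> s1 z ^ t = F1 z" by auto
  show ?case
  proof (intro exI[of _ "\<lambda>z. s1 z * E z"] conjI ballI)
    show "continuous_on (- insert p P) (\<lambda>z. s1 z * E z)"
      by (intro continuous_intros continuous_on_subset[OF contE] continuous_on_subset[OF s1(1)]) auto
    fix z assume "z \<in> - insert p P"
    then show "(s1 z * E z) ^ t = F z"
      using s1(2)[of z] E0[of z] by (simp add: F1_def power_mult_distrib)
  qed
qed

lemma punctured_S2_homeomorphic_complex:
  assumes "y \<in> S2"
  obtains \<tau> \<tau>' where "homeomorphism (S2 - {y}) (UNIV :: complex set) \<tau> \<tau>'"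
proof -
  have "(S2 - {y}) homeomorphic (UNIV :: complex set)"
    by (rule homeomorphic_punctured_sphere_affine) (use assms in auto)
  then show ?thesis using that by (auto simp: homeomorphic_def)
qed

text \<open>
  One of the omitted points is sent to infinity, which turns the complement of the others into a
  plane without finitely many points.
\<close>
lemma continuous_root_on_S2_minus_finite:
  fixes F :: "real^3 \<Rightarrow> complex"
  assumes Q: "finite Q" "Q \<subseteq> S2" "Q \<noteq> {}" and t: "t \<ge> 1"
    and contF: "continuous_on (S2 - Q) F" and F0: "\<And>y. y \<in> S2 - Q \<Longrightarrow> F y \<noteq> 0"
    and loc: "\<And>y. y \<in> Q \<Longrightarrow> \<exists>U s. openin (top_of_set S2) U \<and> y \<in> U \<and>
                continuous_on (U - Q) s \<and> (\<forall>u\<in>U - Q. s u ^ t = F u)"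
  obtains s where "continuous_on (S2 - Q) s" "\<And>y. y \<in> S2 - Q \<Longrightarrow> s y ^ t = F y"
proof -
  obtain c where c: "c \<in> Q" using Q by auto
  then obtain \<tau> \<tau>' where \<tau>: "homeomorphism (S2 - {c}) (UNIV :: complex set) \<tau> \<tau>'"
    using punctured_S2_homeomorphic_complex Q by blast
  have \<tau>': "\<tau>' z \<in> S2 - {c}" "\<tau> (\<tau>' z) = z" for z
    using \<tau> unfolding homeomorphism_def by blast+
  have \<tau>'\<tau>: "\<tau>' (\<tau> y) = y" if "y \<in> S2" "y \<noteq> c" for y
    using \<tau> that by (auto simp: homeomorphism_def)
  have cont\<tau>: "continuous_on (S2 - {c}) \<tau>" and cont\<tau>': "continuous_on UNIV \<tau>'"
    using \<tau> by (auto simp: homeomorphism_def)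
  define P where "P = \<tau> ` (Q - {c})"
  have PQ: "z \<in> P \<longleftrightarrow> \<tau>' z \<in> Q" for z
  proof
    assume "z \<in> P"
    then show "\<tau>' z \<in> Q" using \<tau>'\<tau> Q by (auto simp: P_def)
  next
    assume "\<tau>' z \<in> Q"
    then have "\<tau> (\<tau>' z) \<in> P" using \<tau>'(1)[of z] by (auto simp: P_def)
    then show "z \<in> P" by (simp add: \<tau>')
  qed
  have "\<exists>s. continuous_on (- P) s \<and> (\<forall>z\<in>- P. s z ^ t = (F \<circ> \<tau>') z)"
  proof (rule continuous_root_on_finite_complement)
    show "finite P" using Q by (simp add: P_def)
    show "continuous_on (- P) (F \<circ> \<tau>')"
      by (intro continuous_on_compose continuous_on_subset[OF cont\<tau>'] continuous_on_subset[OF contF])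
         (use PQ \<tau>' in auto)
    show "(F \<circ> \<tau>') z \<noteq> 0" if "z \<notin> P" for z using F0 \<tau>'(1)[of z] that PQ by auto
    fix p assume "p \<in> P"
    then have "\<tau>' p \<in> Q" using PQ by simp
    from loc[OF this] obtain U s where U: "openin (top_of_set S2) U" "\<tau>' p \<in> U"
      and s: "continuous_on (U - Q) s" "\<And>u. u \<in> U - Q \<Longrightarrow> s u ^ t = F u" by blast
    have "openin (top_of_set (S2 - {c})) ((S2 - {c}) \<inter> U)"
    proof -
      obtain T where "open T" "U = S2 \<inter> T" using U(1) by (auto simp: openin_open)
      then show ?thesis by (auto simp: openin_open)
    qed
    then have "open (\<tau> ` ((S2 - {c}) \<inter> U))"
      using homeomorphism_imp_open_map[OF \<tau>] by simp
    moreover have "\<tau> ` ((S2 - {c}) \<inter> U) = {z. \<tau>' z \<in> U}"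
    proof (intro equalityI subsetI)
      fix z assume "z \<in> {z. \<tau>' z \<in> U}"
      then show "z \<in> \<tau> ` ((S2 - {c}) \<inter> U)" using \<tau>'[of z] by (intro image_eqI[of _ _ "\<tau>' z"]) auto
    next
      fix z assume "z \<in> \<tau> ` ((S2 - {c}) \<inter> U)"
      then obtain x where "x \<in> S2" "x \<noteq> c" "x \<in> U" "z = \<tau> x" by blast
      then show "z \<in> {z. \<tau>' z \<in> U}" using \<tau>'\<tau>[of x] by simp
    qed
    ultimately have "open {z. \<tau>' z \<in> U}" by simp
    then show "\<exists>U s. open U \<and> p \<in> U \<and> continuous_on (U - P) s \<and> (\<forall>z\<in>U - P. s z ^ t = (F \<circ> \<tau>') z)"
    proof (intro exI[of _ "{z. \<tau>' z \<in> U}"] exI[of _ "s \<circ> \<tau>'"] conjI)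
      show "continuous_on ({z. \<tau>' z \<in> U} - P) (s \<circ> \<tau>')"
        by (intro continuous_on_compose continuous_on_subset[OF cont\<tau>'] continuous_on_subset[OF s(1)])
           (use PQ in auto)
    qed (use U s PQ in auto)
  qed (use t in auto)
  then obtain s where s: "continuous_on (- P) s" "\<And>z. z \<notin> P \<Longrightarrow> s z ^ t = F (\<tau>' z)" by auto
  show ?thesis
  proof (rule that[of "s \<circ> \<tau>"])
    have P\<tau>: "\<tau> y \<notin> P" if "y \<in> S2 - Q" for y
    proof -
      have "y \<noteq> c" "y \<in> S2" using that c by auto
      then show ?thesis using \<tau>'\<tau>[of y] PQ that by auto
    qed
    show "continuous_on (S2 - Q) (s \<circ> \<tau>)"
      by (intro continuous_on_compose continuous_on_subset[OF cont\<tau>] continuous_on_subset[OF s(1)])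
         (use P\<tau> c in auto)
    show "(s \<circ> \<tau>) y ^ t = F y" if "y \<in> S2 - Q" for y
    proof -
      have "y \<noteq> c" "y \<in> S2" using that c by auto
      then show ?thesis using \<tau>'\<tau>[of y] s(2)[OF P\<tau>[OF that]] by simp
    qed
  qed
qed

section \<open>Power charts and local degrees\<close>

text \<open>
  The chart domains of \<open>has_local_degree\<close> are homeomorphic to the whole plane and cannot simply be
  cut down.  Charts onto discs can be made arbitrarily small; the radius on the target is \<open>R ^ m\<close>
  so that \<open>z \<mapsto> z ^ m\<close> maps the one disc onto the other.
\<close>
definition power_chart ::
  "'a::topological_space set \<Rightarrow> ('a \<Rightarrow> 'b::topological_space) \<Rightarrow> 'a \<Rightarrow> nat \<Rightarrow> real \<Rightarrow> 'a set \<Rightarrow> 'b set \<Rightarrow>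
    ('a \<Rightarrow> complex) \<Rightarrow> (complex \<Rightarrow> 'a) \<Rightarrow> ('b \<Rightarrow> complex) \<Rightarrow> (complex \<Rightarrow> 'b) \<Rightarrow> bool" where
  "power_chart Y f y m R N V \<phi> \<phi>' \<psi> \<psi>' \<longleftrightarrow>
     m \<ge> 1 \<and> R > 0 \<and> openin (top_of_set Y) N \<and> y \<in> N \<and>
     homeomorphism N (ball 0 R) \<phi> \<phi>' \<and> \<phi> y = 0 \<and>
     homeomorphism V (ball 0 (R ^ m)) \<psi> \<psi>' \<and> \<psi> (f y) = 0 \<and>
     f ` N \<subseteq> V \<and> (\<forall>u\<in>N. \<psi> (f u) = \<phi> u ^ m)"

text \<open>
  With \<open>R \<le> 1\<close> one has \<open>R ^ m \<le> R\<close>, so a single radius serves for both smallness conditions.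
\<close>
lemma has_local_degree_power_chart:
  assumes "has_local_degree Y X f y m"
    and "openin (top_of_set Y) M" "y \<in> M" and "openin (top_of_set X) W" "f y \<in> W"
  obtains R N V \<phi> \<phi>' \<psi> \<psi>' where "power_chart Y f y m R N V \<phi> \<phi>' \<psi> \<psi>'" "N \<subseteq> M" "V \<subseteq> W"
proof -
  from assms(1) obtain U V \<phi> \<phi>' \<psi> \<psi>' where m: "m \<ge> 1"
    and U: "openin (top_of_set Y) U" "y \<in> U" and V: "openin (top_of_set X) V" "f ` U \<subseteq> V"
    and \<phi>: "homeomorphism U (UNIV :: complex set) \<phi> \<phi>'" "\<phi> y = 0"
    and \<psi>: "homeomorphism V (UNIV :: complex set) \<psi> \<psi>'" "\<psi> (f y) = 0"
    and pow: "\<And>u. u \<in> U \<Longrightarrow> \<psi> (f u) = \<phi> u ^ m"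
    unfolding has_local_degree_def by metis
  have small: "\<exists>R>0. \<forall>z\<in>ball 0 R. \<phi>' z \<in> M"
    if "openin (top_of_set Y) U" "y \<in> U" "homeomorphism U (UNIV :: complex set) \<phi> \<phi>'" "\<phi> y = 0"
      "openin (top_of_set Y) M" "y \<in> M" for Y :: "'z::topological_space set" and U \<phi> \<phi>' y M
  proof -
    have "openin (top_of_set U) (U \<inter> M)"
      using that(1,5) by (metis openin_Int openin_subset_trans inf_le1 openin_imp_subset)
    then have "open (\<phi> ` (U \<inter> M))" using homeomorphism_imp_open_map[OF that(3)] by simp
    moreover have "0 \<in> \<phi> ` (U \<inter> M)" using that by (metis IntI image_eqI)
    ultimately obtain R where R: "R > 0" "ball 0 R \<subseteq> \<phi> ` (U \<inter> M)" by (meson open_contains_ball)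
    have "\<phi>' z \<in> M" if "z \<in> ball 0 R" for z
    proof -
      have "z \<in> \<phi> ` (U \<inter> M)" using that R(2) by blast
      then obtain u where "u \<in> U" "u \<in> M" "z = \<phi> u" by blast
      then show ?thesis using \<open>homeomorphism U UNIV \<phi> \<phi>'\<close> by (simp add: homeomorphism_def)
    qed
    then show ?thesis using R(1) by blast
  qed
  obtain R1 where R1: "R1 > 0" "\<And>z. z \<in> ball 0 R1 \<Longrightarrow> \<phi>' z \<in> M"
    using small[OF U \<phi> assms(2,3)] by blast
  obtain R2 where R2: "R2 > 0" "\<And>z. z \<in> ball 0 R2 \<Longrightarrow> \<psi>' z \<in> W"
    using small[OF V(1) _ \<psi> assms(4,5)] U(2) V(2) by blast
  define R where "R = min R1 (min 1 R2)"
  have R: "R > 0" "R \<le> 1" "R \<le> R1" "R \<le> R2" using R1 R2 by (auto simp: R_def)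
  have Rm: "R ^ m \<le> R" using R m power_decreasing[of 1 m R] by simp
  define N where "N = \<phi>' ` ball 0 R"
  define V' where "V' = \<psi>' ` ball 0 (R ^ m)"
  have inv\<phi>: "\<phi> (\<phi>' z) = z" "\<phi>' z \<in> U" for z using \<phi>(1) by (auto simp: homeomorphism_def)
  have inv\<psi>: "\<psi> (\<psi>' z) = z" "\<psi>' z \<in> V" for z using \<psi>(1) by (auto simp: homeomorphism_def)
  have N: "openin (top_of_set Y) N"
  proof -
    have "openin (top_of_set U) N"
      unfolding N_def using homeomorphism_imp_open_map[OF homeomorphism_symD[OF \<phi>(1)]] by simp
    then show ?thesis using U(1) openin_trans by blast
  qed
  have yN: "y \<in> N" using \<phi> U(2) R(1) unfolding N_def homeomorphism_def
    by (metis centre_in_ball imageI)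
  have \<phi>N: "homeomorphism N (ball 0 R) \<phi> \<phi>'"
    by (rule homeomorphism_of_subsets[OF \<phi>(1)]) (auto simp: N_def inv\<phi> image_image)
  have \<psi>V: "homeomorphism V' (ball 0 (R ^ m)) \<psi> \<psi>'"
    by (rule homeomorphism_of_subsets[OF \<psi>(1)]) (auto simp: V'_def inv\<psi> image_image)
  have fN: "f ` N \<subseteq> V'"
  proof
    fix x assume "x \<in> f ` N"
    then obtain z where z: "z \<in> ball 0 R" "x = f (\<phi>' z)" by (auto simp: N_def)
    have "x = \<psi>' (z ^ m)"
      using pow[OF inv\<phi>(2)[of z]] V(2) inv\<phi>[of z] z(2) \<psi>(1) unfolding homeomorphism_def
      by (metis image_subset_iff)
    moreover have "norm (z ^ m) < R ^ m"
      using z(1) m by (simp add: norm_power power_strict_mono)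
    ultimately show "x \<in> V'" by (auto simp: V'_def)
  qed
  have "\<psi> (f u) = \<phi> u ^ m" if "u \<in> N" for u
    using that pow inv\<phi> by (auto simp: N_def)
  then have "power_chart Y f y m R N V' \<phi> \<phi>' \<psi> \<psi>'"
    using m R(1) N yN \<phi>N \<psi>V fN \<phi>(2) \<psi>(2) by (auto simp: power_chart_def)
  moreover have "N \<subseteq> M" using R1 R by (auto simp: N_def)
  moreover have "V' \<subseteq> W" using R2 R Rm by (auto simp: V'_def)
  ultimately show ?thesis by (rule that)
qed

lemma power_chart_facts:
  assumes "power_chart Y f y m R N V \<phi> \<phi>' \<psi> \<psi>'"
  shows "m \<ge> 1" "R > 0" "openin (top_of_set Y) N" "y \<in> N" "\<phi> y = 0" "\<psi> (f y) = 0"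
    and "continuous_on N \<phi>" "continuous_on (ball 0 R) \<phi>'"
    and "continuous_on V \<psi>" "continuous_on (ball 0 (R ^ m)) \<psi>'"
    and "\<And>u. u \<in> N \<Longrightarrow> norm (\<phi> u) < R" "\<And>u. u \<in> N \<Longrightarrow> \<phi>' (\<phi> u) = u" 
    and "\<And>z. norm z < R \<Longrightarrow> \<phi>' z \<in> N" "\<And>z. norm z < R \<Longrightarrow> \<phi> (\<phi>' z) = z"
    and "\<And>u. u \<in> N \<Longrightarrow> f u = \<psi>' (\<phi> u ^ m)" 
    and "\<And>z. norm z < R ^ m \<Longrightarrow> \<psi>' z \<in> V" "\<And>z. norm z < R ^ m \<Longrightarrow> \<psi> (\<psi>' z) = z"
    and "\<And>u. u \<in> N \<Longrightarrow> f u = f y \<longleftrightarrow> u = y"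
    and "\<psi>' 0 = f y"
    and "\<And>u. u \<in> N \<Longrightarrow> \<phi> u = 0 \<longleftrightarrow> u = y"
proof -
  have *: "m \<ge> 1" "R > 0" "y \<in> N" "homeomorphism N (ball 0 R) \<phi> \<phi>'" "\<phi> y = 0"
     "homeomorphism V (ball 0 (R ^ m)) \<psi> \<psi>'" "\<psi> (f y) = 0"
     "f ` N \<subseteq> V" "\<And>u. u \<in> N \<Longrightarrow> \<psi> (f u) = \<phi> u ^ m" and N: "openin (top_of_set Y) N"
    using assms by (auto simp: power_chart_def)
  show "m \<ge> 1" "R > 0" "y \<in> N" "\<phi> y = 0" "\<psi> (f y) = 0" "openin (top_of_set Y) N" by fact+
  show "continuous_on N \<phi>" "continuous_on (ball 0 R) \<phi>'" "continuous_on V \<psi>" "continuous_on (ball 0 (R ^ m)) \<psi>'"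
    using *(4,6) by (simp_all add: homeomorphism_def)
  show "norm (\<phi> u) < R" if "u \<in> N" for u using homeomorphism_image1[OF *(4)] that by auto
  show inj: "\<phi>' (\<phi> u) = u" if "u \<in> N" for u using homeomorphism_apply1[OF *(4) that] .
  show "\<phi>' z \<in> N" if "norm z < R" for z using homeomorphism_image2[OF *(4)] that by auto
  show "\<phi> (\<phi>' z) = z" if "norm z < R" for z using homeomorphism_apply2[OF *(4)] that by simp
  show "\<psi>' z \<in> V" if "norm z < R ^ m" for z using homeomorphism_image2[OF *(6)] that by auto
  show "\<psi> (\<psi>' z) = z" if "norm z < R ^ m" for z using homeomorphism_apply2[OF *(6)] that by simp
  show fu: "f u = \<psi>' (\<phi> u ^ m)" if "u \<in> N" for u
    using *(9)[OF that] homeomorphism_apply1[OF *(6), of "f u"] *(8) that by auto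
  show "f u = f y \<longleftrightarrow> u = y" if "u \<in> N" for u
  proof
    assume "f u = f y"
    then have "\<phi> u ^ m = 0" using *(9)[OF that] *(7) by simp
    then have "\<phi> u = \<phi> y" using *(5) by simp
    then show "u = y" using inj that *(3) by metis
  qed simp
  show "\<phi> u = 0 \<longleftrightarrow> u = y" if "u \<in> N" for u
    using inj[OF that] inj[OF *(3)] *(5) by auto
  show "\<psi>' 0 = f y" using fu[OF *(3)] *(1,5) by (simp add: power_0_left)
qed

lemma continuous_on_openin_cover:
  fixes f :: "'a::topological_space \<Rightarrow> 'b::topological_space"
  assumes "\<And>y. y \<in> Y \<Longrightarrow> openin (top_of_set Y) (N y)" "\<And>y. y \<in> Y \<Longrightarrow> y \<in> N y"
    and "\<And>y. y \<in> Y \<Longrightarrow> continuous_on (N y) f"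
  shows "continuous_on Y f"
proof -
  have "continuous_map (top_of_set Y) euclidean f"
  proof (rule pasting_lemma[where I = Y and T = N and f = "\<lambda>_. f"])
    fix y assume y: "y \<in> Y"
    then have "Y \<inter> N y = N y" using assms(1) openin_imp_subset by blast
    then show "continuous_map (subtopology (top_of_set Y) (N y)) euclidean f"
      using assms(3)[OF y] by (simp add: subtopology_subtopology)
  qed (use assms in auto)
  then show ?thesis by simp
qed

lemma has_local_degree_continuous_on:
  assumes "\<And>y. y \<in> Y \<Longrightarrow> \<exists>m. has_local_degree Y X f y m"
    and "f ` Y \<subseteq> X"
  shows "continuous_on Y f"
proof -
  have "\<exists>N. openin (top_of_set Y) N \<and> y \<in> N \<and> continuous_on N f" if y: "y \<in> Y" for y
  proof -
    from assms(1) y obtain m where m: "has_local_degree Y X f y m" by blast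
    have fy: "f y \<in> X" using assms(2) y by auto
    obtain R N V \<phi> \<phi>' \<psi> \<psi>' where c: "power_chart Y f y m R N V \<phi> \<phi>' \<psi> \<psi>'"
      using has_local_degree_power_chart[OF m openin_subtopology_self y openin_subtopology_self fy] by metis
    note c = power_chart_facts[OF c]
    have "continuous_on N (\<lambda>u. \<psi>' (\<phi> u ^ m))"
      by (intro continuous_on_compose2[OF c(10)] continuous_intros c(7))
         (use c(1,2,11) in \<open>auto simp: norm_power intro!: power_strict_mono\<close>)
    then have "continuous_on N f" by (rule continuous_on_eq) (simp add: c(15))
    then show ?thesis using c by blast
  qed
  then obtain N where N: "\<And>y. y \<in> Y \<Longrightarrow> openin (top_of_set Y) (N y) \<and> y \<in> N y \<and> continuous_on (N y) f"
    by metis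
  show ?thesis by (rule continuous_on_openin_cover[of Y N]) (simp_all add: N)
qed

lemma power_chart_connected_punctured:
  assumes "power_chart Y f y m R N V \<phi> \<phi>' \<psi> \<psi>'"
  shows "connected (N - {y})"
proof -
  note c = power_chart_facts[OF assms]
  have "connected (ball (0::complex) R - {0})"
    using aff_dim_open[of "ball (0::complex) R"] c(2) by (intro connected_punctured_convex) simp_all
  then have "connected (\<phi>' ` (ball 0 R - {0}))"
    by (rule connected_continuous_image[rotated]) (rule continuous_on_subset[OF c(8)], auto)
  also have "\<phi>' ` (ball 0 R - {0}) = N - {y}"
  proof (intro equalityI subsetI)
    fix u assume "u \<in> \<phi>' ` (ball 0 R - {0})"
    then obtain w where "w \<in> ball 0 R - {0}" "u = \<phi>' w" by (rule imageE)
    then have w: "norm w < R" "w \<noteq> 0" "u = \<phi>' w" by auto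
    then have "u \<in> N" "\<phi> u \<noteq> \<phi> y" using c(5,13,14) by simp_all
    then show "u \<in> N - {y}" by blast
  next
    fix u assume u: "u \<in> N - {y}"
    then have "\<phi> u \<noteq> 0" using c(20)[of u] by simp
    then show "u \<in> \<phi>' ` (ball 0 R - {0})" using u c(11,12) by (intro image_eqI[of _ _ "\<phi> u"]) auto
  qed
  finally show ?thesis .
qed

text \<open>
  In the chart, \<open>G \<circ> f\<close> is \<open>w \<mapsto> G (\<psi>' (w ^ m))\<close>, a function of \<open>(w ^ k) ^ t\<close> for \<open>m = k * t\<close>.
\<close>
lemma power_chart_root:
  fixes G :: "'b::topological_space \<Rightarrow> complex"
  assumes "power_chart Y f y m R N V \<phi> \<phi>' \<psi> \<psi>'" and t: "t \<ge> 1" "t dvd m"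
    and contG: "continuous_on (V - {f y}) G" and G0: "\<And>x. x \<in> V - {f y} \<Longrightarrow> G x \<noteq> 0"
  obtains s where "continuous_on (N - {y}) s" "\<And>u. u \<in> N - {y} \<Longrightarrow> s u ^ t = G (f u)"
proof -
  note c = power_chart_facts[OF assms(1)]
  obtain k where k: "m = k * t" using t(2) by (metis dvd_def mult.commute)
  have \<psi>0: "\<psi>' w \<in> V - {f y}" if "w \<in> ball 0 (R ^ m) - {0}" for w
  proof -
    have "\<psi> (\<psi>' w) \<noteq> \<psi> (f y)" "\<psi>' w \<in> V" using that c(6,16,17) by auto
    then show ?thesis by auto
  qed
  have H: "continuous_on (ball 0 (R ^ m) - {0}) (\<lambda>w. G (\<psi>' w))"
    by (intro continuous_on_compose2[OF contG] continuous_on_subset[OF c(10)]) (use \<psi>0 in auto)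
  have H0: "G (\<psi>' w) \<noteq> 0" if "w \<in> ball 0 (R ^ m) - {0}" for w
    using G0[OF \<psi>0[OF that]] .
  from continuous_root_of_comp_power[OF t(1) H H0] obtain S where
    S: "continuous_on {w. w \<noteq> 0 \<and> w ^ t \<in> ball 0 (R ^ m)} S"
    "\<And>w. w \<noteq> 0 \<Longrightarrow> w ^ t \<in> ball 0 (R ^ m) \<Longrightarrow> S w ^ t = G (\<psi>' (w ^ t))"
    by blast
  have D: "\<phi> u ^ k \<noteq> 0 \<and> (\<phi> u ^ k) ^ t \<in> ball 0 (R ^ m)" if "u \<in> N - {y}" for u
  proof -
    have "\<phi> u \<noteq> 0" using that c(20)[of u] by simp
    moreover have "norm (\<phi> u ^ m) < R ^ m"
      using that c(1,2,11) by (simp add: norm_power power_strict_mono)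
    ultimately show ?thesis by (simp add: k power_mult)
  qed
  show ?thesis
  proof (rule that[of "\<lambda>u. S (\<phi> u ^ k)"])
    show "continuous_on (N - {y}) (\<lambda>u. S (\<phi> u ^ k))"
      by (intro continuous_on_compose2[OF S(1)] continuous_intros continuous_on_subset[OF c(7)])
         (use D in auto)
    show "S (\<phi> u ^ k) ^ t = G (f u)" if "u \<in> N - {y}" for u
      using S(2) D[OF that] c(15) that by (auto simp: k power_mult)
  qed
qed

text \<open>
  Every value near \<open>f y\<close> other than \<open>f y\<close> itself is taken \<open>m\<close> times, once at each \<open>m\<close>-th root of its
  coordinate, and there are infinitely many such values, so that the finite set \<open>B\<close> can be avoided.
\<close>
lemma power_chart_many_preimages:
  assumes "power_chart Y f y m R N V \<phi> \<phi>' \<psi> \<psi>'" and "finite B"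
  obtains x M where "x \<in> V - B" "x \<noteq> f y" "M \<subseteq> N - {y}" "card M = m" "finite M" "\<And>u. u \<in> M \<Longrightarrow> f u = x"
proof -
  note c = power_chart_facts[OF assms(1)]
  have "inj_on \<psi>' (ball 0 (R ^ m))" using c(17) by (intro inj_on_inverseI[of _ \<psi>]) simp
  moreover have "infinite (ball (0::complex) (R ^ m))" using c(2) by (simp add: uncountable_infinite uncountable_ball)
  ultimately have "infinite (\<psi>' ` ball 0 (R ^ m))" by (simp add: finite_image_iff)
  then have "\<not> \<psi>' ` ball 0 (R ^ m) \<subseteq> insert (f y) B" using assms(2) finite_subset by blast
  then obtain x where x: "x \<in> \<psi>' ` ball 0 (R ^ m)" "x \<notin> insert (f y) B" by blast
  from x(1) obtain w where "w \<in> ball 0 (R ^ m)" "x = \<psi>' w" by (rule imageE)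
  then have w: "norm w < R ^ m" "\<psi>' w \<notin> B" "\<psi>' w \<noteq> f y" using x(2) by auto
  have w0: "w \<noteq> 0" using w c(19) by auto
  define Z where "Z = {z::complex. z ^ m = w}"
  have Z: "finite Z" "card Z = m"
    using card_nth_roots[OF w0, of m] finite_nth_roots[of m w] c(1) by (auto simp: Z_def)
  have ZR: "norm z < R" if "z \<in> Z" for z
  proof -
    have "norm z ^ m < R ^ m" using that w by (auto simp: Z_def norm_power)
    then show ?thesis using c(2) power_less_imp_less_base less_imp_le by blast
  qed
  have "inj_on \<phi>' Z" using c(14) ZR by (intro inj_on_inverseI[of _ \<phi>]) simp
  then have "card (\<phi>' ` Z) = m" using Z by (simp add: card_image)
  moreover have f: "f (\<phi>' z) = \<psi>' w" if "z \<in> Z" for z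
    using c(15)[OF c(13)[OF ZR[OF that]]] c(14)[OF ZR[OF that]] that by (simp add: Z_def)
  moreover have "\<phi>' ` Z \<subseteq> N - {y}" using c(13) ZR f w(3) by auto
  ultimately show ?thesis using that[of "\<psi>' w" "\<phi>' ` Z"] w c(16) Z(1) by auto
qed

lemma power_chart_card_fibre_le:
  assumes "power_chart Y f y m R N V \<phi> \<phi>' \<psi> \<psi>'" and M: "M \<subseteq> N" "\<And>u. u \<in> M \<Longrightarrow> f u = x"
  shows "card M \<le> m"
proof -
  note c = power_chart_facts[OF assms(1)]
  have m: "m > 0" using c(1) by simp
  define Z where "Z = {z::complex. z ^ m = \<psi> x}"
  have "\<phi> u ^ m = \<psi> x" if "u \<in> M" for u
  proof -
    have "u \<in> N" using that M(1) by auto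
    moreover have "norm (\<phi> u ^ m) < R ^ m"
      using c(11)[OF \<open>u \<in> N\<close>] c(2) m by (simp add: norm_power power_strict_mono)
    ultimately show ?thesis using M(2)[OF that] c(15)[of u] c(17)[of "\<phi> u ^ m"] by simp
  qed
  then have "\<phi> ` M \<subseteq> Z" by (auto simp: Z_def)
  moreover have "inj_on \<phi> M" using c(12) M(1) by (intro inj_on_inverseI[of _ \<phi>']) auto
  moreover have "finite Z \<and> card Z \<le> m"
  proof (cases "\<psi> x = 0")
    case True
    then have "Z = {0}" using m by (auto simp: Z_def)
    then show ?thesis using m by auto
  next
    case False
    then show ?thesis using card_nth_roots[of "\<psi> x" m] finite_nth_roots[of m "\<psi> x"] m by (auto simp: Z_def)
  qed
  ultimately show ?thesis by (meson card_inj_on_le le_trans)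
qed

text \<open>
  The local degree is the largest number of points that the fibres have in small neighbourhoods
  of \<open>y\<close>: a chart of degree \<open>m\<close> bounds these numbers by \<open>m\<close>, and one of degree \<open>m'\<close> attains \<open>m'\<close>
  in every neighbourhood of \<open>y\<close>.
\<close>
lemma has_local_degree_unique:
  assumes "has_local_degree Y X f y m" "has_local_degree Y X f y m'" "y \<in> Y" "f y \<in> X"
  shows "m = m'"
proof -
  have "m' \<le> m" if m: "has_local_degree Y X f y m" and m': "has_local_degree Y X f y m'" for m m'
  proof -
    obtain R N V \<phi> \<phi>' \<psi> \<psi>' where c: "power_chart Y f y m R N V \<phi> \<phi>' \<psi> \<psi>'"
      using has_local_degree_power_chart[OF m openin_subtopology_self assms(3) openin_subtopology_self assms(4)] by metis
    obtain R2 N2 V2 \<phi>2 \<phi>2' \<psi>2 \<psi>2' where c2: "power_chart Y f y m' R2 N2 V2 \<phi>2 \<phi>2' \<psi>2 \<psi>2'" "N2 \<subseteq> N"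
      using has_local_degree_power_chart[OF m' power_chart_facts(3,4)[OF c] openin_subtopology_self assms(4)] by metis
    obtain x M where "M \<subseteq> N2 - {y}" "card M = m'" "\<And>u. u \<in> M \<Longrightarrow> f u = x"
      by (rule power_chart_many_preimages[OF c2(1), of "{}"]) auto
    then show ?thesis using power_chart_card_fibre_le[OF c, of M x] c2(2) by auto
  qed
  from this[OF assms(1,2)] this[OF assms(2,1)] show ?thesis by simp
qed

lemma branched_cover_local_degree:
  assumes "branched_cover Y X f" "y \<in> Y"
  shows "has_local_degree Y X f y (local_degree Y X f y)"
proof -
  obtain m where m: "has_local_degree Y X f y m" using assms by (auto simp: branched_cover_def)
  have "f y \<in> X" using assms by (auto simp: branched_cover_def)
  then have "local_degree Y X f y = m"
    unfolding local_degree_def using has_local_degree_unique[OF _ m assms(2)] m by blast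
  then show ?thesis using m by simp
qed

section \<open>Fibres of proper local homeomorphisms, and the dihedral quotient map\<close>

lemma finite_imp_separated:
  fixes F :: "'a::metric_space set"
  assumes "finite F"
  obtains d where "d > 0" "\<And>x y. x \<in> F \<Longrightarrow> y \<in> F \<Longrightarrow> x \<noteq> y \<Longrightarrow> d \<le> dist x y"
proof -
  define D where "D = insert 1 ((\<lambda>(x, y). dist x y) ` {(x, y) \<in> F \<times> F. x \<noteq> y})"
  have "finite {(x, y) \<in> F \<times> F. x \<noteq> y}" using assms by (auto intro: finite_subset[of _ "F \<times> F"])
  then have D: "finite D" "D \<noteq> {}" by (auto simp: D_def)
  show ?thesis
  proof (rule that[of "Min D"])
    show "Min D > 0" using D by (auto simp: D_def)
    show "Min D \<le> dist x y" if "x \<in> F" "y \<in> F" "x \<noteq> y" for x y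
      using that by (intro Min_le[OF D(1)]) (force simp: D_def)
  qed
qed

text \<open>
  The compactness assumption is properness of \<open>u\<close> over a neighbourhood of \<open>w0\<close>.  By it, the fibre
  over \<open>w0\<close> is finite, and points over values close to \<open>w0\<close> cannot escape from given
  neighbourhoods of this fibre; in disjoint neighbourhoods on which \<open>u\<close> is injective and open
  each of these values is taken exactly once.
\<close>
lemma card_fibre_locally_constant:
  fixes u :: "'a::metric_space \<Rightarrow> 'b::metric_space"
  assumes contu: "continuous_on \<Omega> u" and r: "r > 0"
    and K: "compact {y \<in> \<Omega>. u y \<in> cball w0 r}"
    and loc: "\<And>y. y \<in> \<Omega> \<Longrightarrow> u y = w0 \<Longrightarrow> \<exists>U. openin (top_of_set \<Omega>) U \<and> y \<in> U \<and> inj_on u U \<and>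
               (\<forall>U'. openin (top_of_set \<Omega>) U' \<longrightarrow> U' \<subseteq> U \<longrightarrow> open (u ` U'))"
  shows "finite {y \<in> \<Omega>. u y = w0}"
    and "\<exists>\<delta>>0. \<forall>w\<in>ball w0 \<delta>. card {y \<in> \<Omega>. u y = w} = card {y \<in> \<Omega>. u y = w0}"
proof -
  define K where "K = {y \<in> \<Omega>. u y \<in> cball w0 r}"
  define F where "F = {y \<in> \<Omega>. u y = w0}"
  have KF: "compact K" "K \<subseteq> \<Omega>" "F \<subseteq> K" using K r by (auto simp: K_def F_def)
  have contK: "continuous_on K u" using contu KF(2) by (rule continuous_on_subset)
  have "closedin (top_of_set K) (K \<inter> u -` {w0})"
    using contK by (rule continuous_closedin_preimage) simp
  moreover have "K \<inter> u -` {w0} = F" using r by (auto simp: K_def F_def)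
  ultimately have "compact F" using closedin_compact KF(1) by metis
  have "\<forall>y\<in>F. \<exists>T. open T \<and> y \<in> T \<and> inj_on u (\<Omega> \<inter> T) \<and> (\<forall>T'. open T' \<longrightarrow> open (u ` (\<Omega> \<inter> T \<inter> T')))"
  proof
    fix y assume "y \<in> F"
    then have "y \<in> \<Omega>" "u y = w0" by (auto simp: F_def)
    from loc[OF this] obtain U where U: "openin (top_of_set \<Omega>) U" "y \<in> U" "inj_on u U"
      "\<And>U'. openin (top_of_set \<Omega>) U' \<Longrightarrow> U' \<subseteq> U \<Longrightarrow> open (u ` U')" by blast
    obtain T where T: "open T" "U = \<Omega> \<inter> T" using U(1) by (auto simp: openin_open)
    have "open (u ` (\<Omega> \<inter> T \<inter> T'))" if "open T'" for T'
    proof (rule U(4))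
      show "openin (top_of_set \<Omega>) (\<Omega> \<inter> T \<inter> T')"
        using T(1) that by (metis Int_assoc open_Int openin_open_Int)
    qed (use T in auto)
    then show "\<exists>T. open T \<and> y \<in> T \<and> inj_on u (\<Omega> \<inter> T) \<and> (\<forall>T'. open T' \<longrightarrow> open (u ` (\<Omega> \<inter> T \<inter> T')))"
      using T U(2,3) by auto
  qed
  then obtain T where T: "\<And>y. y \<in> F \<Longrightarrow> open (T y)" "\<And>y. y \<in> F \<Longrightarrow> y \<in> T y"
    "\<And>y. y \<in> F \<Longrightarrow> inj_on u (\<Omega> \<inter> T y)"
    "\<And>y T'. y \<in> F \<Longrightarrow> open T' \<Longrightarrow> open (u ` (\<Omega> \<inter> T y \<inter> T'))" by metis
  have uF: "u y = w0" "y \<in> \<Omega>" if "y \<in> F" for y using that by (auto simp: F_def)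
  have finF: "finite F"
  proof -
    obtain C where C: "C \<subseteq> F" "finite C" "F \<subseteq> (\<Union>c\<in>C. T c)"
      using compactE_image[OF \<open>compact F\<close>, of F T] T(1,2) by blast
    have "y \<in> C" if "y \<in> F" for y
    proof -
      obtain c where c: "c \<in> C" "y \<in> T c" using C(3) \<open>y \<in> F\<close> by blast
      then have "c \<in> F" using C(1) by blast
      have "u y = u c" using uF(1) \<open>y \<in> F\<close> \<open>c \<in> F\<close> by metis
      then have "y = c"
        using inj_onD[OF T(3)[OF \<open>c \<in> F\<close>], of y c] uF(2) \<open>y \<in> F\<close> \<open>c \<in> F\<close> c(2) T(2) by blast
      then show ?thesis using c by simp
    qed
    then have "F \<subseteq> C" by (rule subsetI)
    then show ?thesis using C(2) by (rule finite_subset)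
  qed
  then show "finite {y \<in> \<Omega>. u y = w0}" by (simp add: F_def)
  obtain d where d: "d > 0" "\<And>x y. x \<in> F \<Longrightarrow> y \<in> F \<Longrightarrow> x \<noteq> y \<Longrightarrow> d \<le> dist x y"
    using finite_imp_separated[OF finF] by blast
  define N where "N = (\<lambda>y. \<Omega> \<inter> T y \<inter> ball y (d / 2))"
  have inj: "y = y'" if "y \<in> N a" "y' \<in> N a" "u y = u y'" "a \<in> F" for y y' a
    using inj_onD[OF T(3)[OF \<open>a \<in> F\<close>] \<open>u y = u y'\<close>] that by (auto simp: N_def)
  have disj: "a = b" if "y \<in> N a" "y \<in> N b" "a \<in> F" "b \<in> F" for y a b
  proof (rule ccontr)
    assume "a \<noteq> b"
    then have "d \<le> dist a b" using d that by blast
    moreover have "dist a y < d / 2" "dist b y < d / 2" using that by (auto simp: N_def)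
    ultimately show False using dist_triangle2[of a b y] by linarith
  qed
  \<comment> \<open>The part of \<open>K\<close> away from the fibre has a compact image, which omits a neighbourhood of \<open>w0\<close>.\<close>
  define K' where "K' = K - (\<Union>y\<in>F. T y \<inter> ball y (d / 2))"
  have "compact K'" unfolding K'_def by (intro compact_diff KF(1) open_UN ballI open_Int T) auto
  then have "compact (u ` K')"
    by (intro compact_continuous_image continuous_on_subset[OF contK]) (auto simp: K'_def)
  then have "closed (u ` K')" by (rule compact_imp_closed)
  moreover have "w0 \<notin> u ` K'"
  proof
    assume "w0 \<in> u ` K'"
    then obtain y where y: "y \<in> K'" "u y = w0" by auto
    then have "y \<in> F" using KF(2) by (auto simp: F_def K'_def)
    then show False using y(1) T(2) d(1) by (auto simp: K'_def)
  qed
  ultimately have "open (- (u ` K'))" "w0 \<in> - (u ` K')" by auto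
  moreover have "open (\<Inter>y\<in>F. u ` N y)" unfolding N_def using finF T(4) by (intro open_INT) auto
  moreover have "w0 \<in> (\<Inter>y\<in>F. u ` N y)" using uF T(2) d(1) by (force simp: N_def)
  ultimately have "open (- (u ` K') \<inter> (\<Inter>y\<in>F. u ` N y))" "w0 \<in> - (u ` K') \<inter> (\<Inter>y\<in>F. u ` N y)"
    by (blast intro: open_Int)+
  then obtain \<delta> where \<delta>: "\<delta> > 0" "ball w0 \<delta> \<subseteq> - (u ` K') \<inter> (\<Inter>y\<in>F. u ` N y)"
    by (meson open_contains_ball)
  have "card {y \<in> \<Omega>. u y = w} = card F" if w: "w \<in> ball w0 (min \<delta> r)" for w
  proof -
    have "\<forall>y\<in>F. \<exists>x. x \<in> N y \<and> u x = w"
    proof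
      fix y assume "y \<in> F"
      have "w \<in> ball w0 \<delta>" using w by auto
      then have "w \<in> u ` N y" using \<delta>(2) \<open>y \<in> F\<close> by blast
      then show "\<exists>x. x \<in> N y \<and> u x = w" by blast
    qed
    then obtain g where g: "\<And>y. y \<in> F \<Longrightarrow> g y \<in> N y \<and> u (g y) = w" by metis
    have "bij_betw g F {y \<in> \<Omega>. u y = w}"
    proof (intro bij_betw_imageI)
      show "inj_on g F" using g disj by (intro inj_onI) metis
      show "g ` F = {y \<in> \<Omega>. u y = w}"
      proof (intro equalityI subsetI)
        fix x assume "x \<in> g ` F"
        then show "x \<in> {y \<in> \<Omega>. u y = w}" using g by (auto simp: N_def)
      next
        fix x assume x: "x \<in> {y \<in> \<Omega>. u y = w}"
        then have "x \<in> K" using w by (auto simp: K_def)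
        moreover have "x \<notin> K'"
        proof
          assume "x \<in> K'"
          then have "w \<in> u ` K'" using x by auto
          moreover have "w \<in> ball w0 \<delta>" using w by auto
          ultimately show False using \<delta>(2) by blast
        qed
        ultimately obtain y where y: "y \<in> F" "x \<in> N y" using x by (auto simp: K'_def N_def)
        then have "x = g y" using inj[of x y "g y"] g[OF y(1)] x by auto
        then show "x \<in> g ` F" using y(1) by blast
      qed
    qed
    then show ?thesis using bij_betw_same_card by metis
  qed
  then have "\<forall>w\<in>ball w0 (min \<delta> r). card {y \<in> \<Omega>. u y = w} = card F" by blast
  moreover have "min \<delta> r > 0" using \<delta>(1) r by simp
  ultimately have "\<exists>\<delta>>0. \<forall>w\<in>ball w0 \<delta>. card {y \<in> \<Omega>. u y = w} = card F" by blast
  then show "\<exists>\<delta>>0. \<forall>w\<in>ball w0 \<delta>. card {y \<in> \<Omega>. u y = w} = card {y \<in> \<Omega>. u y = w0}"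
    unfolding F_def .
qed

text \<open>
  Distinct points with equal \<open>t\<close>-th power differ by a factor \<open>\<zeta> \<noteq> 1\<close> with \<open>\<zeta> ^ t = 1\<close>, and such
  factors keep a distance \<open>\<rho>\<close> from \<open>1\<close>.
\<close>
lemma power_locally_injective:
  fixes w0 :: complex
  assumes "w0 \<noteq> 0" "t \<ge> 1"
  obtains e where "e > 0" "inj_on (\<lambda>w. w ^ t) (ball w0 e)"
proof -
  have "finite {\<zeta>::complex. \<zeta> ^ t = 1}" using assms(2) by (intro finite_roots_unity) simp
  then obtain \<rho> where \<rho>: "\<rho> > 0"
    "\<And>x y. x \<in> {\<zeta>::complex. \<zeta> ^ t = 1} \<Longrightarrow> y \<in> {\<zeta>. \<zeta> ^ t = 1} \<Longrightarrow> x \<noteq> y \<Longrightarrow> \<rho> \<le> dist x y"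
    using finite_imp_separated by blast
  define e where "e = min (norm w0 / 2) (\<rho> * norm w0 / 4)"
  show ?thesis
  proof (rule that[of e])
    show "e > 0" using \<rho>(1) assms by (simp add: e_def)
    show "inj_on (\<lambda>w. w ^ t) (ball w0 e)"
    proof (intro inj_onI, rule ccontr)
      fix w w' assume w: "w \<in> ball w0 e" "w' \<in> ball w0 e" "w ^ t = w' ^ t" "w \<noteq> w'"
      have "norm w0 \<le> norm w + norm (w0 - w)" by (metis add.commute diff_add_cancel norm_triangle_ineq)
      moreover have "norm (w0 - w) < norm w0 / 2" using w(1) by (simp add: dist_norm e_def)
      ultimately have nw: "norm w > norm w0 / 2" by linarith
      then have w0: "w \<noteq> 0" using assms(1) by auto
      have "(w' / w) ^ t = w ^ t / w ^ t" by (simp only: power_divide w(3))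
      then have "(w' / w) ^ t = 1" using w0 by simp
      then have "\<rho> \<le> dist (w' / w) 1" using w(4) w0 by (intro \<rho>(2)) auto
      then have "\<rho> * norm w \<le> dist (w' / w) 1 * norm w" by (intro mult_right_mono) auto
      also have "\<dots> = norm ((w' / w - 1) * w)" by (simp only: dist_norm norm_mult)
      also have "(w' / w - 1) * w = w' - w" using w0 by (simp add: field_simps)
      also have "norm (w' - w) = dist w' w" by (simp add: dist_norm)
      also have "\<dots> \<le> dist w0 w' + dist w0 w" by (rule dist_triangle3)
      also have "\<dots> < 2 * e" using w by simp
      also have "\<dots> \<le> \<rho> * (norm w0 / 2)" by (simp add: e_def)
      also have "\<dots> < \<rho> * norm w" using \<rho>(1) nw by simp
      finally show False .
    qed
  qed
qed

text \<open>
  The equation is \<open>q\<^sup>2 - 2 * c * q + 1 = 0\<close>, with roots \<open>c + s\<close> and \<open>c - s\<close> for \<open>s\<^sup>2 = c\<^sup>2 - 1\<close>.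
\<close>
lemma joukowski_preimage:
  fixes c :: complex
  obtains q1 q2 where "q1 \<noteq> 0" "q2 \<noteq> 0" "q1 * q2 = 1" "q1 = q2 \<longleftrightarrow> c = 1 \<or> c = - 1"
    "\<And>q. q \<noteq> 0 \<Longrightarrow> (q + 1 / q) / 2 = c \<longleftrightarrow> q = q1 \<or> q = q2"
proof -
  define s where "s = csqrt (c\<^sup>2 - 1)"
  have s: "s\<^sup>2 = c\<^sup>2 - 1" by (simp add: s_def)
  have p: "(c + s) * (c - s) = 1" using s by (simp add: algebra_simps power2_eq_square)
  show ?thesis
  proof (rule that[of "c + s" "c - s"])
    show "c + s \<noteq> 0" "c - s \<noteq> 0" using p by auto
    show "(c + s) * (c - s) = 1" by (rule p)
    have "c + s = c - s \<longleftrightarrow> s = 0" by (auto simp: eq_neg_iff_add_eq_0 simp flip: mult_2)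
    also have "\<dots> \<longleftrightarrow> c\<^sup>2 = 1" using s by auto
    finally show "c + s = c - s \<longleftrightarrow> c = 1 \<or> c = - 1" by (simp add: power2_eq_1_iff)
    fix q :: complex assume q: "q \<noteq> 0"
    have "(q - (c + s)) * (q - (c - s)) = q * q - 2 * c * q + 1"
      using p by (simp add: algebra_simps)
    also have "\<dots> = 2 * q * ((q + 1 / q) / 2 - c)" using q by (simp add: field_simps)
    finally show "(q + 1 / q) / 2 = c \<longleftrightarrow> q = c + s \<or> q = c - s" using q
      by (metis eq_iff_diff_eq_0 mult_eq_0_iff zero_neq_numeral)
  qed
qed

text \<open>
  The map \<open>w \<mapsto> (w ^ t + 1 / w ^ t) / 2\<close> has degree \<open>2 * t\<close> and is branched over \<open>1\<close>, \<open>- 1\<close> and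
  infinity only.
\<close>
lemma chebyshev_preimage:
  assumes "t \<ge> 1"
  shows "finite {w::complex. w \<noteq> 0 \<and> (w ^ t + 1 / w ^ t) / 2 = c}"
    and "c \<noteq> 1 \<Longrightarrow> c \<noteq> - 1 \<Longrightarrow> card {w::complex. w \<noteq> 0 \<and> (w ^ t + 1 / w ^ t) / 2 = c} = 2 * t"
proof -
  obtain q1 q2 where q: "q1 \<noteq> 0" "q2 \<noteq> 0" "q1 * q2 = 1" "q1 = q2 \<longleftrightarrow> c = 1 \<or> c = - 1"
    "\<And>q. q \<noteq> 0 \<Longrightarrow> (q + 1 / q) / 2 = c \<longleftrightarrow> q = q1 \<or> q = q2"
    using joukowski_preimage[of c] by blast
  have *: "{w. w \<noteq> 0 \<and> (w ^ t + 1 / w ^ t) / 2 = c} = {w. w ^ t = q1} \<union> {w. w ^ t = q2}"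
    using q assms by (auto simp: zero_power)
  show "finite {w. w \<noteq> 0 \<and> (w ^ t + 1 / w ^ t) / 2 = c}"
    unfolding * using assms finite_nth_roots by auto
  assume "c \<noteq> 1" "c \<noteq> - 1"
  then have "q1 \<noteq> q2" using q(4) by simp
  then have "card ({w. w ^ t = q1} \<union> {w. w ^ t = q2}) = card {w. w ^ t = q1} + card {w. w ^ t = q2}"
    using assms finite_nth_roots by (intro card_Un_disjoint) auto
  then show "card {w. w \<noteq> 0 \<and> (w ^ t + 1 / w ^ t) / 2 = c} = 2 * t"
    unfolding * using card_nth_roots q(1,2) assms by simp
qed

section \<open>Factorization through the dihedral quotient\<close>

lemma S2_coordinate:
  assumes "x1 \<in> S2" "x2 \<in> S2" "x3 \<in> S2" "x1 \<noteq> x2" "x1 \<noteq> x3" "x2 \<noteq> x3"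
  obtains \<sigma> \<sigma>' where "homeomorphism (S2 - {x3}) (UNIV :: complex set) \<sigma> \<sigma>'" "\<sigma> x1 = 1" "\<sigma> x2 = - 1"
proof -
  obtain \<tau> \<tau>' where \<tau>: "homeomorphism (S2 - {x3}) (UNIV :: complex set) \<tau> \<tau>'"
    using punctured_S2_homeomorphic_complex assms(3) by blast
  define a b where "a = \<tau> x1" and "b = \<tau> x2"
  have "a \<noteq> b" using \<tau> assms unfolding a_def b_def homeomorphism_def by (metis Diff_iff singletonD)
  define g where "g = (\<lambda>z. (2 * z - a - b) / (a - b))"
  define g' where "g' = (\<lambda>w. (w * (a - b) + a + b) / 2)"
  have g1: "g' (g z) = z" for z
    using \<open>a \<noteq> b\<close> by (simp add: g_def g'_def)
  have "2 * g' w - a - b = w * (a - b)" for w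
    by (simp add: g'_def del: distrib_left_numeral)
  then have g2: "g (g' w) = w" for w using \<open>a \<noteq> b\<close> by (simp add: g_def)
  have "homeomorphism UNIV UNIV g g'"
  proof (rule homeomorphismI)
    show "continuous_on UNIV g" "continuous_on UNIV g'"
      unfolding g_def g'_def using \<open>a \<noteq> b\<close> by (auto intro!: continuous_intros)
  qed (use g1 g2 in auto)
  then have "homeomorphism (S2 - {x3}) UNIV (g \<circ> \<tau>) (\<tau>' \<circ> g')"
    by (rule homeomorphism_compose[OF \<tau>])
  moreover have "(g \<circ> \<tau>) x1 = 1" "(g \<circ> \<tau>) x2 = - 1"
    using \<open>a \<noteq> b\<close> by (simp_all add: g_def a_def b_def divide_eq_minus_1_iff)
  ultimately show ?thesis by (rule that)
qed

lemma S2_coordinate_near_puncture: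
  assumes \<sigma>: "homeomorphism (S2 - {p}) (UNIV :: complex set) \<sigma> \<sigma>'" and p: "p \<in> S2"
  obtains W where "openin (top_of_set S2) W" "p \<in> W" "\<And>x. x \<in> W \<Longrightarrow> x \<noteq> p \<Longrightarrow> norm (\<sigma> x) > R"
proof -
  have cont: "continuous_on UNIV \<sigma>'" and im: "\<sigma>' z \<in> S2 - {p}" for z
    using \<sigma> unfolding homeomorphism_def by blast+
  have "compact (\<sigma>' ` cball 0 R)"
    by (intro compact_continuous_image continuous_on_subset[OF cont]) auto
  then have "open (- (\<sigma>' ` cball 0 R))" by (simp add: compact_imp_closed open_Compl)
  show ?thesis
  proof (rule that[of "S2 \<inter> - (\<sigma>' ` cball 0 R)"])
    show "openin (top_of_set S2) (S2 \<inter> - (\<sigma>' ` cball 0 R))" by (rule openin_open_Int) fact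
    show "p \<in> S2 \<inter> - (\<sigma>' ` cball 0 R)" using im p by blast
    fix x assume x: "x \<in> S2 \<inter> - (\<sigma>' ` cball 0 R)" "x \<noteq> p"
    then have "\<sigma>' (\<sigma> x) = x" using \<sigma> by (simp add: homeomorphism_def)
    then have "\<sigma> x \<notin> cball 0 R" using x(1) by (metis ComplD IntD2 image_eqI)
    then show "norm (\<sigma> x) > R" by simp
  qed
qed

lemma continuous_on_square_root:
  fixes v F :: "'a::topological_space \<Rightarrow> complex"
  assumes F: "continuous_on S F" and sq: "\<And>y. y \<in> S \<Longrightarrow> (v y)\<^sup>2 = F y"
    and v: "continuous_on {y \<in> S. F y \<noteq> 0} v"
  shows "continuous_on S v"
  unfolding continuous_on_def
proof
  fix y assume y: "y \<in> S"
  show "(v \<longlongrightarrow> v y) (at y within S)"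
  proof (cases "F y = 0")
    case True
    have "(F \<longlongrightarrow> 0) (at y within S)" using F y True by (metis continuous_on_def)
    then have "((\<lambda>x. sqrt (norm (F x))) \<longlongrightarrow> sqrt (norm (0::complex))) (at y within S)"
      by (intro tendsto_intros)
    moreover have "\<forall>\<^sub>F x in at y within S. sqrt (norm (F x)) = norm (v x)"
      unfolding eventually_at_filter using sq by (auto simp: norm_power simp flip: sq intro!: always_eventually)
    ultimately have "((\<lambda>x. norm (v x)) \<longlongrightarrow> 0) (at y within S)"
      by (simp add: tendsto_cong)
    moreover have "v y = 0" using sq[OF y] True by simp
    ultimately show ?thesis by (simp add: tendsto_norm_zero_iff)
  next
    case False
    have "openin (top_of_set S) (S \<inter> F -` (- {0}))"
      using F by (rule continuous_openin_preimage_gen) (simp add: open_Compl)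
    then obtain T where T: "open T" "S \<inter> F -` (- {0}) = S \<inter> T" by (auto simp: openin_open)
    have eq: "{y \<in> S. F y \<noteq> 0} = S \<inter> T" using T(2) by auto
    have yT: "y \<in> S \<inter> T" using y False eq by blast
    then have "(v \<longlongrightarrow> v y) (at y within S \<inter> T)" using v eq by (simp add: continuous_on_def)
    also have "at y within S \<inter> T = at y within S"
      by (rule at_within_nhd[of y T]) (use yT T in auto)
    finally show ?thesis .
  qed
qed

text \<open>
  The branch of the square root of \<open>z\<^sup>2 - 1\<close> outside the unit disc that is asymptotic to \<open>z\<close> at
  infinity.
\<close>
definition outer_root :: "complex \<Rightarrow> complex" where
  "outer_root z = z * csqrt (1 - 1 / z\<^sup>2)"

lemma outer_root_squared: "z \<noteq> 0 \<Longrightarrow> (outer_root z)\<^sup>2 = z\<^sup>2 - 1"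
  by (simp add: outer_root_def power_mult_distrib field_simps)

lemma continuous_on_outer_root: "continuous_on {z. norm z > 1} outer_root"
proof -
  have "1 - 1 / z\<^sup>2 \<notin> \<real>\<^sub>\<le>\<^sub>0" if "norm z > 1" for z :: complex
  proof -
    have "1 < norm z ^ 2" using that by (intro one_less_power) auto
    then have "norm (1 / z\<^sup>2) < 1" by (simp add: norm_divide norm_power divide_less_eq_1)
    then have "Re (1 / z\<^sup>2) < 1" using complex_Re_le_cmod order_le_less_trans by blast
    then show ?thesis by (auto simp: complex_nonpos_Reals_iff)
  qed
  then show ?thesis unfolding outer_root_def
    by (intro continuous_intros continuous_on_compose2[OF continuous_on_csqrt]) auto
qed

text \<open>
  The orbifold with underlying sphere and cone points \<open>x1\<close>, \<open>x2\<close>, \<open>x3\<close> of orders \<open>2\<close>, \<open>2\<close>, \<open>t\<close> is the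
  quotient of the sphere by a dihedral group.  The divisibility assumptions make \<open>f\<close> a map of
  orbifolds from the simply connected sphere into it, which is why \<open>f\<close> lifts through the quotient.
\<close>
locale dihedral_branching =
  fixes f :: "real^3 \<Rightarrow> real^3" and d t :: nat and x1 x2 x3 :: "real^3"
  assumes cover: "branched_cover S2 S2 f" and degree: "has_cover_degree S2 S2 f d"
    and finite_branch_points: "finite (branch_points S2 S2 f)"
    and in_S2: "x1 \<in> S2" "x2 \<in> S2" "x3 \<in> S2"
    and distinct: "x1 \<noteq> x2" "x1 \<noteq> x3" "x2 \<noteq> x3"
    and finite_fibre: "\<And>x. x \<in> {x1, x2, x3} \<Longrightarrow> finite {y \<in> S2. f y = x}"
    and even_degree: "\<And>y. y \<in> S2 \<Longrightarrow> f y \<in> {x1, x2} \<Longrightarrow> 2 dvd local_degree S2 S2 f y"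
    and t_dvd_degree: "\<And>y. y \<in> S2 \<Longrightarrow> f y = x3 \<Longrightarrow> t dvd local_degree S2 S2 f y"
    and t_pos: "t \<ge> 1"
begin

abbreviation "deg y \<equiv> local_degree S2 S2 f y"

definition \<Omega> where "\<Omega> = {y \<in> S2. f y \<noteq> x3}"

lemma f_image: "f ` S2 = S2"
  using cover unfolding branched_cover_def by (rule conjunct1)

lemma f_S2: "y \<in> S2 \<Longrightarrow> f y \<in> S2"
  using f_image by (metis imageI)

lemma f_surj: "x \<in> S2 \<Longrightarrow> \<exists>y\<in>S2. f y = x"
  using f_image by (metis imageE)

lemma continuous_f: "continuous_on S2 f"
  using has_local_degree_continuous_on[of S2 S2 f] cover unfolding branched_cover_def by blast

lemma chart:
  assumes "y \<in> S2" "openin (top_of_set S2) M" "y \<in> M" "openin (top_of_set S2) W" "f y \<in> W"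
  obtains R N V \<phi> \<phi>' \<psi> \<psi>' where "power_chart S2 f y (deg y) R N V \<phi> \<phi>' \<psi> \<psi>'" "N \<subseteq> M" "V \<subseteq> W"
  using has_local_degree_power_chart[OF branched_cover_local_degree[OF cover assms(1)] assms(2-)] by blast

lemma openin_\<Omega>: "openin (top_of_set S2) \<Omega>"
proof -
  have "openin (top_of_set S2) (S2 \<inter> f -` (- {x3}))"
    using continuous_f by (rule continuous_openin_preimage_gen) (simp add: open_Compl)
  moreover have "S2 \<inter> f -` (- {x3}) = \<Omega>" by (auto simp: \<Omega>_def)
  ultimately show ?thesis by simp
qed

text \<open>
  Local square roots of \<open>Z\<^sup>2 - 1\<close>, \<open>Z = \<sigma> \<circ> f\<close>, exist over \<open>x1\<close> and \<open>x2\<close> because the local degrees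
  there are even, and over \<open>x3\<close>, where \<open>Z\<close> tends to infinity, because \<open>outer_root\<close> is one.
  At the zeros of \<open>Z\<^sup>2 - 1\<close> the global root is extended by \<open>0\<close>.
\<close>
lemma square_root_lift:
  assumes \<sigma>: "homeomorphism (S2 - {x3}) (UNIV :: complex set) \<sigma> \<sigma>'" "\<sigma> x1 = 1" "\<sigma> x2 = - 1"
  obtains v where "continuous_on \<Omega> v" "\<And>y. y \<in> \<Omega> \<Longrightarrow> (v y)\<^sup>2 = (\<sigma> (f y))\<^sup>2 - 1"
proof -
  have cont\<sigma>: "continuous_on (S2 - {x3}) \<sigma>" and inj\<sigma>: "\<And>x. x \<in> S2 - {x3} \<Longrightarrow> \<sigma>' (\<sigma> x) = x"
    using \<sigma>(1) by (auto simp: homeomorphism_def)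
  have \<sigma>1: "\<sigma> x = 1 \<longleftrightarrow> x = x1" and \<sigma>2: "\<sigma> x = - 1 \<longleftrightarrow> x = x2" if "x \<in> S2" "x \<noteq> x3" for x
    using inj\<sigma>[of x] inj\<sigma>[of x1] inj\<sigma>[of x2] \<sigma>(2,3) that in_S2 distinct by auto
  define Q where "Q = {y \<in> S2. f y \<in> {x1, x2, x3}}"
  have contF: "continuous_on \<Omega> (\<lambda>y. (\<sigma> (f y))\<^sup>2 - 1)"
    by (intro continuous_intros continuous_on_compose2[OF cont\<sigma>] continuous_on_subset[OF continuous_f])
       (use f_S2 in \<open>auto simp: \<Omega>_def\<close>)
  have F0: "(\<sigma> x)\<^sup>2 - 1 \<noteq> 0" if "x \<in> S2 - {x1, x2, x3}" for x
    using \<sigma>1[of x] \<sigma>2[of x] that by (auto simp: power2_eq_1_iff)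
  have Q\<Omega>: "S2 - Q \<subseteq> \<Omega>" by (auto simp: Q_def \<Omega>_def)
  have loc: "\<exists>U s. openin (top_of_set S2) U \<and> y \<in> U \<and> continuous_on (U - Q) s \<and>
          (\<forall>u\<in>U - Q. (s u)\<^sup>2 = (\<sigma> (f u))\<^sup>2 - 1)" if "y \<in> Q" for y
  proof -
    have y: "y \<in> S2" "f y \<in> {x1, x2, x3}" using that by (auto simp: Q_def)
    show ?thesis
    proof (cases "f y = x3")
      case True
      obtain W where W: "openin (top_of_set S2) W" "x3 \<in> W" "\<And>x. x \<in> W \<Longrightarrow> x \<noteq> x3 \<Longrightarrow> norm (\<sigma> x) > 1"
        using S2_coordinate_near_puncture[OF \<sigma>(1) in_S2(3), of 1] by blast
      define U where "U = S2 \<inter> f -` W"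
      have "openin (top_of_set S2) U"
        unfolding U_def using continuous_openin_preimage[OF continuous_f _ W(1)] f_S2 by auto
      moreover have "y \<in> U" using y True W by (auto simp: U_def)
      moreover have U\<Omega>: "U - Q \<subseteq> S2" "f ` (U - Q) \<subseteq> S2 - {x3}"
        unfolding U_def Q_def using f_S2 by blast+
      moreover have *: "norm (\<sigma> (f u)) > 1" if "u \<in> U - Q" for u
        using W(3)[of "f u"] that by (auto simp: U_def Q_def)
      moreover have "continuous_on (U - Q) (\<lambda>u. outer_root (\<sigma> (f u)))"
        by (intro continuous_on_compose2[OF continuous_on_outer_root] continuous_on_compose2[OF cont\<sigma>]
             continuous_on_subset[OF continuous_f])
           (use * U\<Omega> in force)+
      moreover have "(outer_root (\<sigma> (f u)))\<^sup>2 = (\<sigma> (f u))\<^sup>2 - 1" if "u \<in> U - Q" for u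
        using *[OF that] by (intro outer_root_squared) auto
      ultimately show ?thesis by blast
    next
      case False
      define W where "W = S2 - ({x1, x2, x3} - {f y})"
      have "openin (top_of_set S2) W"
        unfolding W_def by (intro openin_diff finite_imp_closedin) (use in_S2 in auto)
      moreover have "f y \<in> W" using y f_S2 by (auto simp: W_def)
      ultimately obtain R N V \<phi> \<phi>' \<psi> \<psi>' where c: "power_chart S2 f y (deg y) R N V \<phi> \<phi>' \<psi> \<psi>'" "V \<subseteq> W"
        using chart[OF y(1) openin_subtopology_self y(1)] by metis
      have VS: "V - {f y} \<subseteq> S2 - {x1, x2, x3}" using c(2) by (auto simp: W_def)
      have contV: "continuous_on (V - {f y}) (\<lambda>x. (\<sigma> x)\<^sup>2 - 1)"
        by (intro continuous_intros continuous_on_subset[OF cont\<sigma>]) (use VS in blast)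
      have V0: "(\<sigma> x)\<^sup>2 - 1 \<noteq> 0" if "x \<in> V - {f y}" for x
        using F0[of x] VS that by blast
      have "f y \<in> {x1, x2}" using y(2) False by blast
      from power_chart_root[OF c(1) one_le_numeral even_degree[OF y(1) this] contV V0]
      obtain s where s: "continuous_on (N - {y}) s"
         "\<And>u. u \<in> N - {y} \<Longrightarrow> (s u)\<^sup>2 = (\<sigma> (f u))\<^sup>2 - 1" by blast
      have NQ: "N - Q \<subseteq> N - {y}" using that by auto
      have "continuous_on (N - Q) s" using s(1) NQ by (rule continuous_on_subset)
      moreover have "\<forall>u\<in>N - Q. (s u)\<^sup>2 = (\<sigma> (f u))\<^sup>2 - 1" using s(2) NQ by blast
      ultimately show ?thesis using power_chart_facts(3,4)[OF c(1)] by blast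
    qed
  qed
  have finQ: "finite Q"
  proof -
    have "Q = (\<Union>x\<in>{x1, x2, x3}. {y \<in> S2. f y = x})" by (auto simp: Q_def)
    then show ?thesis using finite_fibre by simp
  qed
  have Q: "Q \<subseteq> S2" "Q \<noteq> {}" using f_surj[OF in_S2(1)] by (auto simp: Q_def)
  have FQ0: "(\<sigma> (f y))\<^sup>2 - 1 \<noteq> 0" if "y \<in> S2 - Q" for y
    using F0[of "f y"] f_S2 that by (auto simp: Q_def)
  from continuous_root_on_S2_minus_finite[OF finQ Q one_le_numeral continuous_on_subset[OF contF Q\<Omega>] FQ0 loc]
  obtain v where v: "continuous_on (S2 - Q) v" "\<And>y. y \<in> S2 - Q \<Longrightarrow> (v y)\<^sup>2 = (\<sigma> (f y))\<^sup>2 - 1"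
    by blast
  define v' where "v' = (\<lambda>y. if f y \<in> {x1, x2} then 0 else v y)"
  have sq: "(v' y)\<^sup>2 = (\<sigma> (f y))\<^sup>2 - 1" if "y \<in> \<Omega>" for y
    using that v(2)[of y] \<sigma>(2,3) by (auto simp: v'_def \<Omega>_def Q_def)
  have "{y \<in> \<Omega>. (\<sigma> (f y))\<^sup>2 - 1 \<noteq> 0} \<subseteq> S2 - Q"
    using \<sigma>(2,3) by (auto simp: \<Omega>_def Q_def)
  then have "continuous_on {y \<in> \<Omega>. (\<sigma> (f y))\<^sup>2 - 1 \<noteq> 0} v"
    using v(1) continuous_on_subset by blast
  then have "continuous_on {y \<in> \<Omega>. (\<sigma> (f y))\<^sup>2 - 1 \<noteq> 0} v'"
    by (rule continuous_on_eq) (use \<sigma>(2,3) in \<open>auto simp: v'_def\<close>)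
  then have "continuous_on \<Omega> v'" using continuous_on_square_root[OF contF sq] by blast
  then show ?thesis using sq that by blast
qed

text \<open>
  The function \<open>q\<close> depends only on the value of \<open>f\<close> in a punctured neighbourhood of \<open>y\<close>.  For
  \<open>y\<close> over \<open>x3\<close>, where \<open>f\<close> is a \<open>t\<close>-th power in charts, this gives \<open>q\<close> a local \<open>t\<close>-th root, and it
  leaves this root at most \<open>t\<close> values on each fibre of \<open>f\<close> near \<open>y\<close>.
\<close>
definition descends_near :: "(real^3 \<Rightarrow> complex) \<Rightarrow> real^3 \<Rightarrow> bool" where
  "descends_near q y \<longleftrightarrow>
     (\<exists>R N V \<phi> \<phi>' \<psi> \<psi>' K. power_chart S2 f y (deg y) R N V \<phi> \<phi>' \<psi> \<psi>' \<and>
        continuous_on (V - {x3}) K \<and> (\<forall>x\<in>V - {x3}. K x \<noteq> 0) \<and> (\<forall>u\<in>N - {y}. q u = K (f u)))"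

text \<open>
  With \<open>v\<^sup>2 = Z\<^sup>2 - 1\<close> the function \<open>q = Z + v\<close> satisfies \<open>q * (Z - v) = 1\<close>, hence it has no zeros and
  \<open>q + 1 / q = 2 * Z\<close>.  Near a point over \<open>x3\<close> the roots \<open>v\<close> and \<open>outer_root \<circ> Z\<close> of \<open>Z\<^sup>2 - 1\<close>
  differ by a sign, which is constant since punctured discs are connected.  So \<open>v\<close>, and with it
  \<open>q\<close>, is a function of \<open>f\<close> there.
\<close>
lemma joukowski_lift:
  assumes \<sigma>: "homeomorphism (S2 - {x3}) (UNIV :: complex set) \<sigma> \<sigma>'" "\<sigma> x1 = 1" "\<sigma> x2 = - 1"
  obtains q where "continuous_on \<Omega> q" "\<And>y. y \<in> \<Omega> \<Longrightarrow> q y \<noteq> 0"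
    and "\<And>y. y \<in> \<Omega> \<Longrightarrow> (q y + 1 / q y) / 2 = \<sigma> (f y)"
    and "\<And>y. y \<in> S2 \<Longrightarrow> f y = x3 \<Longrightarrow> descends_near q y"
proof -
  have cont\<sigma>: "continuous_on (S2 - {x3}) \<sigma>" using \<sigma>(1) by (auto simp: homeomorphism_def)
  obtain v where v: "continuous_on \<Omega> v" "\<And>y. y \<in> \<Omega> \<Longrightarrow> (v y)\<^sup>2 = (\<sigma> (f y))\<^sup>2 - 1"
    using square_root_lift[OF \<sigma>] by blast
  define q where "q = (\<lambda>y. \<sigma> (f y) + v y)"
  have q1: "q y * (\<sigma> (f y) - v y) = 1" if "y \<in> \<Omega>" for y
    using v(2)[OF that] by (simp add: q_def algebra_simps power2_eq_square)
  have q0: "q y \<noteq> 0" if "y \<in> \<Omega>" for y using q1[OF that] by auto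
  have qinv: "1 / q y = \<sigma> (f y) - v y" if "y \<in> \<Omega>" for y
    using q1[OF that] q0[OF that] by (simp add: field_simps)
  show ?thesis
  proof (rule that[of q])
    show "continuous_on \<Omega> q" unfolding q_def
      by (intro continuous_intros v continuous_on_compose2[OF cont\<sigma>] continuous_on_subset[OF continuous_f])
         (use f_S2 in \<open>auto simp: \<Omega>_def\<close>)
    show "q y \<noteq> 0" if "y \<in> \<Omega>" for y using q0 that .
    show "(q y + 1 / q y) / 2 = \<sigma> (f y)" if "y \<in> \<Omega>" for y
      by (simp add: qinv[OF that]) (simp add: q_def)
    fix y assume y: "y \<in> S2" "f y = x3"
    obtain W where W: "openin (top_of_set S2) W" "x3 \<in> W" "\<And>x. x \<in> W \<Longrightarrow> x \<noteq> x3 \<Longrightarrow> norm (\<sigma> x) > 1"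
      using S2_coordinate_near_puncture[OF \<sigma>(1) in_S2(3), of 1] by blast
    have "f y \<in> W" using y W by simp
    then obtain R N V \<phi> \<phi>' \<psi> \<psi>' where c: "power_chart S2 f y (deg y) R N V \<phi> \<phi>' \<psi> \<psi>'" "V \<subseteq> W"
      using chart[OF y(1) openin_subtopology_self y(1) W(1)] by metis
    have WS: "W \<subseteq> S2" using W(1) openin_imp_subset by blast
    have NS: "N \<subseteq> S2" using power_chart_facts(3)[OF c(1)] openin_imp_subset by blast
    have fN: "f u \<in> V - {x3} \<and> u \<in> \<Omega> \<and> norm (\<sigma> (f u)) > 1" if "u \<in> N - {y}" for u
    proof -
      have "f u \<noteq> x3" using power_chart_facts(18)[OF c(1), of u] y(2) that by simp
      moreover have "f u \<in> V" using c(1) that by (auto simp: power_chart_def)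
      ultimately show ?thesis using W(3) c(2) NS that by (auto simp: \<Omega>_def)
    qed
    define \<epsilon> where "\<epsilon> = (\<lambda>u. v u / outer_root (\<sigma> (f u)))"
    have or: "(outer_root (\<sigma> (f u)))\<^sup>2 = (\<sigma> (f u))\<^sup>2 - 1" "outer_root (\<sigma> (f u)) \<noteq> 0" if "u \<in> N - {y}" for u
    proof -
      have n: "norm (\<sigma> (f u)) > 1" using fN that by blast
      then show *: "(outer_root (\<sigma> (f u)))\<^sup>2 = (\<sigma> (f u))\<^sup>2 - 1" by (intro outer_root_squared) auto
      have "(\<sigma> (f u))\<^sup>2 \<noteq> 1" using n by (auto simp: power2_eq_1_iff)
      then show "outer_root (\<sigma> (f u)) \<noteq> 0" using * by auto
    qed
    have \<epsilon>: "\<epsilon> u = 1 \<or> \<epsilon> u = - 1" if "u \<in> N - {y}" for u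
    proof -
      have "(v u)\<^sup>2 = (outer_root (\<sigma> (f u)))\<^sup>2" using or(1)[OF that] v(2)[of u] fN[OF that] by simp
      then have "(\<epsilon> u)\<^sup>2 = 1" using or(2)[OF that] by (simp add: \<epsilon>_def power_divide)
      then show ?thesis by (simp add: power2_eq_1_iff)
    qed
    have "\<epsilon> constant_on (N - {y})"
    proof (rule continuous_finite_range_constant)
      show "connected (N - {y})" using power_chart_connected_punctured[OF c(1)] .
      show "continuous_on (N - {y}) \<epsilon>" unfolding \<epsilon>_def
        by (intro continuous_intros continuous_on_subset[OF v(1)] continuous_on_compose2[OF continuous_on_outer_root]
             continuous_on_compose2[OF cont\<sigma>] continuous_on_subset[OF continuous_f])
           (use fN or NS f_S2 in auto)
      show "finite (\<epsilon> ` (N - {y}))"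
        by (rule finite_subset[of _ "{1, - 1}"]) (use \<epsilon> in auto)
    qed
    then obtain e where e: "\<And>u. u \<in> N - {y} \<Longrightarrow> \<epsilon> u = e" by (auto simp: constant_on_def)
    \<comment> \<open>A sign even if \<open>N - {y}\<close> were empty, so that \<open>K\<close> has no zeros.\<close>
    define e' where "e' = (if e = 1 then 1 else - 1 :: complex)"
    have e': "v u = e' * outer_root (\<sigma> (f u))" if "u \<in> N - {y}" for u
      using e[OF that] \<epsilon>[OF that] or(2)[OF that] by (auto simp: \<epsilon>_def e'_def field_simps)
    have e2: "e' * e' = 1" by (simp add: e'_def)
    define K where "K = (\<lambda>x. \<sigma> x + e' * outer_root (\<sigma> x))"
    have V: "norm (\<sigma> x) > 1" "x \<in> S2 - {x3}" if "x \<in> V - {x3}" for x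
      using that W(3) c(2) WS by auto
    have "continuous_on (V - {x3}) K" unfolding K_def
      by (intro continuous_intros continuous_on_compose2[OF continuous_on_outer_root] continuous_on_subset[OF cont\<sigma>])
         (use V in auto)
    moreover have "K x \<noteq> 0" if "x \<in> V - {x3}" for x
    proof -
      have "(outer_root (\<sigma> x))\<^sup>2 = (\<sigma> x)\<^sup>2 - 1"
        using V(1)[OF that] by (intro outer_root_squared) auto
      moreover have "K x * (\<sigma> x - e' * outer_root (\<sigma> x)) = (\<sigma> x)\<^sup>2 - (e' * e') * (outer_root (\<sigma> x))\<^sup>2"
        by (simp add: K_def algebra_simps power2_eq_square)
      ultimately have "K x * (\<sigma> x - e' * outer_root (\<sigma> x)) = 1" using e2 by simp
      then show ?thesis by auto
    qed
    moreover have "q u = K (f u)" if "u \<in> N - {y}" for u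
      using e'[OF that] by (simp add: q_def K_def)
    ultimately show "descends_near q y"
      unfolding descends_near_def using c(1) by blast
  qed
qed

lemma power_lift:
  fixes q :: "real^3 \<Rightarrow> complex"
  assumes contq: "continuous_on \<Omega> q" and q0: "\<And>y. y \<in> \<Omega> \<Longrightarrow> q y \<noteq> 0"
    and loc: "\<And>y. y \<in> S2 \<Longrightarrow> f y = x3 \<Longrightarrow> descends_near q y"
  obtains u where "continuous_on \<Omega> u" "\<And>y. y \<in> \<Omega> \<Longrightarrow> u y ^ t = q y"
proof -
  define Q where "Q = {y \<in> S2. f y = x3}"
  have \<Omega>Q: "S2 - Q = \<Omega>" by (auto simp: Q_def \<Omega>_def)
  have "\<exists>U s. openin (top_of_set S2) U \<and> y \<in> U \<and> continuous_on (U - Q) s \<and> (\<forall>u\<in>U - Q. s u ^ t = q u)"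
    if "y \<in> Q" for y
  proof -
    have y: "y \<in> S2" "f y = x3" using that by (auto simp: Q_def)
    obtain R N V \<phi> \<phi>' \<psi> \<psi>' K where c: "power_chart S2 f y (deg y) R N V \<phi> \<phi>' \<psi> \<psi>'"
      and K: "continuous_on (V - {x3}) K" "\<And>x. x \<in> V - {x3} \<Longrightarrow> K x \<noteq> 0" "\<And>u. u \<in> N - {y} \<Longrightarrow> q u = K (f u)"
      using loc[OF y] unfolding descends_near_def by blast
    from power_chart_root[OF c t_pos t_dvd_degree[OF y], of K] K(1,2) y(2)
    obtain s where s: "continuous_on (N - {y}) s" "\<And>u. u \<in> N - {y} \<Longrightarrow> s u ^ t = K (f u)" by auto
    have NQ: "N - Q \<subseteq> N - {y}" using that by auto
    have "continuous_on (N - Q) s" using s(1) NQ by (rule continuous_on_subset)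
    moreover have "\<forall>u\<in>N - Q. s u ^ t = q u"
    proof
      fix u assume "u \<in> N - Q"
      then have "u \<in> N - {y}" using NQ by blast
      then show "s u ^ t = q u" using s(2) K(3) by metis
    qed
    ultimately show ?thesis using power_chart_facts(3,4)[OF c] by blast
  qed
  moreover have Q: "finite Q" "Q \<subseteq> S2" "Q \<noteq> {}"
    using finite_fibre[of x3] f_surj[OF in_S2(3)] by (auto simp: Q_def)
  ultimately show ?thesis
    using continuous_root_on_S2_minus_finite[OF Q t_pos, of q] contq q0 that unfolding \<Omega>Q by blast
qed

section \<open>Counting the preimages\<close>

definition special_points where "special_points = branch_points S2 S2 f \<union> {x1, x2, x3}"

lemma finite_special_points: "finite special_points"
  using finite_branch_points by (simp add: special_points_def)

lemma locally_injective_off_special_points: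
  assumes y: "y \<in> S2" "f y \<notin> special_points"
  obtains N where "openin (top_of_set S2) N" "y \<in> N" "N \<subseteq> \<Omega>" "inj_on f N"
proof -
  have "y \<in> \<Omega>" using y by (auto simp: \<Omega>_def special_points_def)
  then obtain R N V \<phi> \<phi>' \<psi> \<psi>' where c: "power_chart S2 f y (deg y) R N V \<phi> \<phi>' \<psi> \<psi>'" "N \<subseteq> \<Omega>"
    using chart[OF y(1) openin_\<Omega> _ openin_subtopology_self f_S2[OF y(1)]] by metis
  have "\<not> deg y > 1"
  proof
    assume "deg y > 1"
    then have "f y \<in> branch_points S2 S2 f" unfolding branch_points_def using y(1) f_S2[OF y(1)] by blast
    then show False using y(2) by (simp add: special_points_def)
  qed
  then have deg1: "deg y \<le> 1" by simp
  have "inj_on f N"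
  proof (rule inj_onI, rule ccontr)
    fix a b assume ab: "a \<in> N" "b \<in> N" "f a = f b" "a \<noteq> b"
    have "card {a, b} \<le> deg y"
      by (rule power_chart_card_fibre_le[OF c(1), of _ "f b"]) (use ab in auto)
    then show False using ab(4) deg1 by simp
  qed
  then show ?thesis using that power_chart_facts(3,4)[OF c(1)] c(2) by blast
qed

text \<open>
  Let \<open>\<Phi>\<close> be the dihedral quotient map.  Away from the fibres over special points \<open>f\<close> is locally
  injective, and so is \<open>u\<close>, since \<open>f = \<sigma>' \<circ> \<Phi> \<circ> u\<close>; invariance of domain makes \<open>u\<close> open, and
  compactness of the sphere makes it proper over \<open>A\<close>.  The complement \<open>A\<close> of finitely many values being connected, all values in \<open>A\<close> are taken
  the same number \<open>N\<close> of times.  A generic fibre of \<open>f\<close> is the disjoint union of the fibres of \<open>u\<close>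
  over the \<open>2 * t\<close> points of a fibre of \<open>\<Phi>\<close>, whence \<open>2 * t * N = d\<close>.
\<close>
lemma fibre_count:
  fixes u :: "real^3 \<Rightarrow> complex"
  assumes \<sigma>: "homeomorphism (S2 - {x3}) (UNIV :: complex set) \<sigma> \<sigma>'" "\<sigma> x1 = 1" "\<sigma> x2 = - 1"
    and contu: "continuous_on \<Omega> u"
    and u: "\<And>y. y \<in> \<Omega> \<Longrightarrow> u y \<noteq> 0" "\<And>y. y \<in> \<Omega> \<Longrightarrow> (u y ^ t + 1 / u y ^ t) / 2 = \<sigma> (f y)"
  obtains N where "2 * t * N = d"
    and "\<And>y. y \<in> \<Omega> \<Longrightarrow> f y \<notin> special_points \<Longrightarrow> finite {y' \<in> \<Omega>. u y' = u y} \<and> card {y' \<in> \<Omega>. u y' = u y} = N"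
proof -
  define \<Phi> where "\<Phi> = (\<lambda>w::complex. (w ^ t + 1 / w ^ t) / 2)"
  have \<Phi>u: "\<Phi> (u y) = \<sigma> (f y)" if "y \<in> \<Omega>" for y using u(2)[OF that] by (simp add: \<Phi>_def)
  have \<sigma>': "\<sigma>' z \<in> S2 - {x3}" "\<sigma> (\<sigma>' z) = z" and cont\<sigma>': "continuous_on UNIV \<sigma>'" for z
    using \<sigma>(1) unfolding homeomorphism_def by blast+
  have inj\<sigma>: "\<sigma>' (\<sigma> x) = x" if "x \<in> S2" "x \<noteq> x3" for x
    using \<sigma>(1) that by (simp add: homeomorphism_def)
  have \<sigma>f: "f y = \<sigma>' (\<Phi> (u y))" if "y \<in> \<Omega>" for y
  proof -
    have "f y \<in> S2" "f y \<noteq> x3" using that f_S2[of y] by (auto simp: \<Omega>_def)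
    then show ?thesis using inj\<sigma> \<Phi>u[OF that] by simp
  qed
  have cont\<Phi>: "continuous_on (- {0}) \<Phi>"
    unfolding \<Phi>_def by (intro continuous_intros) auto
  define A where "A = {w. w \<noteq> 0 \<and> \<sigma>' (\<Phi> w) \<notin> special_points}"
  have finA: "finite (- A)"
  proof -
    have "- A \<subseteq> {0} \<union> (\<Union>b\<in>special_points. {w. w \<noteq> 0 \<and> \<Phi> w = \<sigma> b})"
      using \<sigma>'(2) by (fastforce simp: A_def)
    moreover have "finite ({0} \<union> (\<Union>b\<in>special_points. {w. w \<noteq> 0 \<and> \<Phi> w = \<sigma> b}))"
      unfolding \<Phi>_def using finite_special_points chebyshev_preimage(1)[OF t_pos] by simp
    ultimately show ?thesis by (rule finite_subset)
  qed
  have "connected (- (- A))"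
    by (intro path_connected_imp_connected path_connected_complement_countable countable_finite finA) simp
  then have connA: "connected A" by simp
  have fA: "f y \<notin> special_points \<longleftrightarrow> u y \<in> A" if "y \<in> \<Omega>" for y
    using \<sigma>f[OF that] u(1)[OF that] by (simp add: A_def)
  define D where "D = (\<lambda>w. card {y \<in> \<Omega>. u y = w})"
  have local: "finite {y \<in> \<Omega>. u y = w0} \<and> (\<exists>\<delta>>0. \<forall>w\<in>ball w0 \<delta>. D w = D w0)" if w0: "w0 \<in> A" for w0
  proof -
    have "w0 \<noteq> 0" using w0 by (simp add: A_def)
    define r where "r = norm w0 / 2"
    have r: "r > 0" using \<open>w0 \<noteq> 0\<close> by (simp add: r_def)
    have c0: "cball w0 r \<subseteq> - {0}"
    proof
      fix w assume "w \<in> cball w0 r"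
      then show "w \<in> - {0}" using \<open>w0 \<noteq> 0\<close> by (auto simp: r_def)
    qed
    \<comment> \<open>The preimage under \<open>u\<close> of the disc is closed in \<open>L\<close>, which is compact and avoids the fibre
      over \<open>x3\<close>, where \<open>u\<close> is undefined.\<close>
    define L where "L = S2 \<inter> f -` (\<sigma>' ` \<Phi> ` cball w0 r)"
    have "compact (\<sigma>' ` \<Phi> ` cball w0 r)"
      by (intro compact_continuous_image continuous_on_subset[OF cont\<sigma>'] continuous_on_subset[OF cont\<Phi>] c0) auto
    then have "closedin (top_of_set S2) L"
      unfolding L_def using continuous_f compact_imp_closed continuous_closedin_preimage by blast
    then have "compact L" using closedin_compact[OF compact_sphere] by blast
    have L\<Omega>: "L \<subseteq> \<Omega>"
    proof
      fix y assume "y \<in> L"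
      then obtain z where "y \<in> S2" "f y = \<sigma>' z" unfolding L_def by blast
      then show "y \<in> \<Omega>" using \<sigma>'(1)[of z] unfolding \<Omega>_def by simp
    qed
    have "closedin (top_of_set L) (L \<inter> u -` cball w0 r)"
      by (rule continuous_closedin_preimage[OF continuous_on_subset[OF contu L\<Omega>]]) simp
    then have "compact (L \<inter> u -` cball w0 r)" using closedin_compact[OF \<open>compact L\<close>] by blast
    moreover have "L \<inter> u -` cball w0 r = {y \<in> \<Omega>. u y \<in> cball w0 r}"
    proof (intro equalityI subsetI)
      fix y assume y: "y \<in> {y \<in> \<Omega>. u y \<in> cball w0 r}"
      then have "f y \<in> \<sigma>' ` \<Phi> ` cball w0 r" using \<sigma>f by blast
      then show "y \<in> L \<inter> u -` cball w0 r" using y by (simp add: L_def \<Omega>_def)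
    next
      fix y assume "y \<in> L \<inter> u -` cball w0 r"
      then show "y \<in> {y \<in> \<Omega>. u y \<in> cball w0 r}" using L\<Omega> by blast
    qed
    ultimately have K: "compact {y \<in> \<Omega>. u y \<in> cball w0 r}" by simp
    have loc: "\<exists>U. openin (top_of_set \<Omega>) U \<and> y \<in> U \<and> inj_on u U \<and>
               (\<forall>U'. openin (top_of_set \<Omega>) U' \<longrightarrow> U' \<subseteq> U \<longrightarrow> open (u ` U'))"
      if y: "y \<in> \<Omega>" "u y = w0" for y
    proof -
      have "y \<in> S2" "f y \<notin> special_points" using fA[OF y(1)] y w0 by (auto simp: \<Omega>_def)
      then obtain N where N: "openin (top_of_set S2) N" "y \<in> N" "N \<subseteq> \<Omega>" "inj_on f N"
        using locally_injective_off_special_points by metis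
      have inju: "inj_on u N"
      proof (rule inj_onI)
        fix a b assume ab: "a \<in> N" "b \<in> N" "u a = u b"
        then have "a \<in> \<Omega>" "b \<in> \<Omega>" using N(3) by blast+
        then have "f a = f b" using \<sigma>f[of a] \<sigma>f[of b] ab(3) by simp
        then show "a = b" using N(4) ab by (meson inj_onD)
      qed
      have "open (u ` U')" if U': "openin (top_of_set \<Omega>) U'" "U' \<subseteq> N" for U'
      proof -
        have "openin (top_of_set S2) U'" using U'(1) openin_\<Omega> openin_trans by blast
        then have "openin (top_of_set UNIV) (u ` U')"
          by (intro invariance_of_domain_sphere_affine_set[of U' u UNIV 1 0])
             (use U' N(3) inju in \<open>auto intro: continuous_on_subset[OF contu] inj_on_subset\<close>)
        then show ?thesis by simp
      qed
      moreover have "openin (top_of_set \<Omega>) N"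
        using N(1,3) openin_\<Omega> by (meson openin_subset_trans openin_imp_subset)
      ultimately show ?thesis using N(2) inju by blast
    qed
    from card_fibre_locally_constant[OF contu r K loc] show ?thesis unfolding D_def by blast
  qed
  have const: "D a = D b" if "a \<in> A" "b \<in> A" for a b
  proof (rule connected_local_const[OF connA that])
    show "\<forall>a\<in>A. \<forall>\<^sub>F b in at a within A. D a = D b"
    proof
      fix a assume "a \<in> A"
      then obtain \<delta> where "\<delta> > 0" "\<And>w. w \<in> ball a \<delta> \<Longrightarrow> D w = D a" using local by blast
      then have "\<forall>b\<in>A. b \<noteq> a \<and> dist b a < \<delta> \<longrightarrow> D a = D b"
        by (metis dist_commute mem_ball)
      then show "\<forall>\<^sub>F b in at a within A. D a = D b"
        unfolding eventually_at using \<open>\<delta> > 0\<close> by blast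
    qed
  qed
  obtain x where x: "x \<in> S2" "x \<notin> special_points"
  proof -
    have "infinite A" using finA infinite_UNIV_char_0[where 'a = complex] by (metis Compl_partition finite_Un)
    then obtain w where "w \<in> A" by fastforce
    then show ?thesis using that[of "\<sigma>' (\<Phi> w)"] \<sigma>'(1)[of "\<Phi> w"] by (simp add: A_def)
  qed
  define W where "W = {w. w \<noteq> 0 \<and> \<Phi> w = \<sigma> x}"
  have xd: "x \<noteq> x1" "x \<noteq> x2" "x \<noteq> x3" using x by (auto simp: special_points_def)
  have WA: "W \<subseteq> A" using inj\<sigma>[OF x(1) xd(3)] x by (auto simp: W_def A_def)
  have "\<sigma> x \<noteq> 1" "\<sigma> x \<noteq> - 1"
    using inj\<sigma>[OF x(1) xd(3)] inj\<sigma>[OF in_S2(1) distinct(2)] inj\<sigma>[OF in_S2(2) distinct(3)] \<sigma>(2,3) xd by auto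
  then have W: "finite W" "card W = 2 * t"
    using chebyshev_preimage[OF t_pos, of "\<sigma> x"] by (simp_all add: W_def \<Phi>_def)
  then have "W \<noteq> {}" using t_pos by auto
  then obtain w1 where w1: "w1 \<in> W" by blast
  have fibre: "{y \<in> S2. f y = x} = (\<Union>w\<in>W. {y \<in> \<Omega>. u y = w})"
  proof (intro equalityI subsetI)
    fix y assume "y \<in> {y \<in> S2. f y = x}"
    then have "y \<in> \<Omega>" "u y \<in> W" using \<Phi>u[of y] u(1)[of y] xd by (auto simp: \<Omega>_def W_def)
    then show "y \<in> (\<Union>w\<in>W. {y \<in> \<Omega>. u y = w})" by blast
  next
    fix y assume "y \<in> (\<Union>w\<in>W. {y \<in> \<Omega>. u y = w})"
    then have y: "y \<in> \<Omega>" "\<Phi> (u y) = \<sigma> x" by (auto simp: W_def)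
    then show "y \<in> {y \<in> S2. f y = x}" using \<sigma>f[OF y(1)] inj\<sigma>[OF x(1) xd(3)] by (simp add: \<Omega>_def)
  qed
  have "card {y \<in> S2. f y = x} = (\<Sum>w\<in>W. card {y \<in> \<Omega>. u y = w})"
    unfolding fibre by (rule card_UN_disjoint) (use W local WA in auto)
  also have "\<dots> = (\<Sum>w\<in>W. D w1)"
    using const WA w1 unfolding D_def by (intro sum.cong) auto
  also have "\<dots> = 2 * t * D w1" using W by simp
  finally have "2 * t * D w1 = d"
    using degree x unfolding has_cover_degree_def special_points_def by auto
  moreover have "finite {y' \<in> \<Omega>. u y' = u y} \<and> card {y' \<in> \<Omega>. u y' = u y} = D w1"
    if "y \<in> \<Omega>" "f y \<notin> special_points" for y
    using local[of "u y"] const[of "u y" w1] fA[OF that(1)] that(2) WA w1 unfolding D_def by blast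
  ultimately show ?thesis by (rule that)
qed

text \<open>
  Take \<open>deg y\<close> points near \<open>y\<close> with a common generic image \<open>x\<close> under \<open>f\<close>.  It remains to bound the
  number of values of \<open>u\<close> on them.  Over \<open>x3\<close>, \<open>q\<close> is a function of \<open>f\<close>, so \<open>u\<close> takes at most \<open>t\<close>
  values, the roots of \<open>w ^ t = q\<close>.  Otherwise \<open>u\<close> is continuous at \<open>y\<close>, and \<open>w \<mapsto> w ^ t\<close> is injective
  near \<open>u y\<close>; so it suffices to count the values of \<open>q\<close>, which lie among the two solutions of
  \<open>(q + 1 / q) / 2 = \<sigma> x\<close>.  These have product \<open>1\<close>; if \<open>f y\<close> is neither \<open>x1\<close> nor \<open>x2\<close>, then
  \<open>q y * q y \<noteq> 1\<close>, and only one of them is close to \<open>q y\<close>.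
\<close>
theorem local_degree_bound:
  obtains N where "2 * t * N = d"
    and "\<And>y. y \<in> S2 \<Longrightarrow> deg y \<le> (if f y \<in> {x1, x2} then 2 else if f y = x3 then t else 1) * N"
proof -
  obtain \<sigma> \<sigma>' where \<sigma>: "homeomorphism (S2 - {x3}) (UNIV :: complex set) \<sigma> \<sigma>'" "\<sigma> x1 = 1" "\<sigma> x2 = - 1"
    using S2_coordinate[OF in_S2 distinct] by blast
  obtain q where contq: "continuous_on \<Omega> q" and q0: "\<And>y. y \<in> \<Omega> \<Longrightarrow> q y \<noteq> 0"
    and qJ: "\<And>y. y \<in> \<Omega> \<Longrightarrow> (q y + 1 / q y) / 2 = \<sigma> (f y)"
    and qloc: "\<And>y. y \<in> S2 \<Longrightarrow> f y = x3 \<Longrightarrow> descends_near q y"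
    using joukowski_lift[OF \<sigma>] by blast
  obtain u where contu: "continuous_on \<Omega> u" and u: "\<And>y. y \<in> \<Omega> \<Longrightarrow> u y ^ t = q y"
    using power_lift[OF contq q0 qloc] by blast
  have u0: "u y \<noteq> 0" if "y \<in> \<Omega>" for y
    using u[OF that] q0[OF that] t_pos by (auto simp: zero_power)
  have uJ: "(u y ^ t + 1 / u y ^ t) / 2 = \<sigma> (f y)" if "y \<in> \<Omega>" for y
    using qJ[OF that] u[OF that] by simp
  obtain N where N: "2 * t * N = d"
    "\<And>y. y \<in> \<Omega> \<Longrightarrow> f y \<notin> special_points \<Longrightarrow> finite {y' \<in> \<Omega>. u y' = u y} \<and> card {y' \<in> \<Omega>. u y' = u y} = N"
    using fibre_count[OF \<sigma> contu u0 uJ] by blast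
  have pigeonhole: "card M \<le> l * N"
    if M: "finite M" "M \<subseteq> \<Omega>" "\<And>y. y \<in> M \<Longrightarrow> f y \<notin> special_points" and l: "card (u ` M) \<le> l" for M l
  proof -
    have "M \<subseteq> (\<Union>w\<in>u ` M. {y' \<in> \<Omega>. u y' = w})" using M(2) by auto
    then have "card M \<le> card (\<Union>w\<in>u ` M. {y' \<in> \<Omega>. u y' = w})"
      using M N(2) by (intro card_mono) auto
    also have "\<dots> \<le> (\<Sum>w\<in>u ` M. card {y' \<in> \<Omega>. u y' = w})"
      using M(1) by (intro card_UN_le) simp
    also have "\<dots> = (\<Sum>w\<in>u ` M. N)" using M N(2) by (intro sum.cong) auto
    also have "\<dots> \<le> l * N" using l by simp
    finally show ?thesis .
  qed
  have near: "deg y \<le> l * N"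
    if c: "power_chart S2 f y (deg y) R U V \<phi> \<phi>' \<psi> \<psi>'"
      and l: "\<And>M x. M \<subseteq> U - {y} \<Longrightarrow> finite M \<Longrightarrow> M \<subseteq> \<Omega> \<Longrightarrow> (\<And>a. a \<in> M \<Longrightarrow> f a = x) \<Longrightarrow> card (u ` M) \<le> l"
    for y R U V \<phi> \<phi>' \<psi> \<psi>' l
  proof -
    obtain x M where M: "x \<in> V - special_points" "M \<subseteq> U - {y}" "card M = deg y" "finite M" "\<And>a. a \<in> M \<Longrightarrow> f a = x"
      using power_chart_many_preimages[OF c finite_special_points] by metis
    have "U \<subseteq> S2" using power_chart_facts(3)[OF c] openin_imp_subset by blast
    then have "M \<subseteq> \<Omega>" using M by (auto simp: \<Omega>_def special_points_def)
    then have "card M \<le> l * N" using pigeonhole[of M l] l[of M x] M by auto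
    then show ?thesis using M(3) by simp
  qed
  have "deg y \<le> (if f y \<in> {x1, x2} then 2 else if f y = x3 then t else 1) * N" if y: "y \<in> S2" for y
  proof (cases "f y = x3")
    case True
    obtain R U V \<phi> \<phi>' \<psi> \<psi>' and K :: "real^3 \<Rightarrow> complex" where
      c: "power_chart S2 f y (deg y) R U V \<phi> \<phi>' \<psi> \<psi>'" and K: "\<And>a. a \<in> U - {y} \<Longrightarrow> q a = K (f a)"
      using qloc[OF y True] unfolding descends_near_def by blast
    have "deg y \<le> t * N"
    proof (rule near[OF c])
      fix M x assume M: "M \<subseteq> U - {y}" "M \<subseteq> \<Omega>" "\<And>a. a \<in> M \<Longrightarrow> f a = x"
      show "card (u ` M) \<le> t"
      proof (cases "M = {}")
        case False
        then obtain a where a: "a \<in> M" by blast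
        have "u b ^ t = K x" if "b \<in> M" for b
        proof -
          have "b \<in> \<Omega>" "b \<in> U - {y}" "f b = x" using M that by blast+
          then show ?thesis using u[of b] K[of b] by simp
        qed
        then have "u ` M \<subseteq> {w. w ^ t = K x}" by blast
        moreover have "K x \<noteq> 0"
        proof -
          have "a \<in> \<Omega>" "a \<in> U - {y}" "f a = x" using M a by blast+
          then show ?thesis using q0[of a] K[of a] by simp
        qed
        ultimately show ?thesis
          using card_mono[OF finite_nth_roots] card_nth_roots t_pos by (metis One_nat_def Suc_le_eq)
      qed simp
    qed
    then show ?thesis using True distinct by simp
  next
    case False
    then have y\<Omega>: "y \<in> \<Omega>" using y by (simp add: \<Omega>_def)
    obtain e where e: "e > 0" "inj_on (\<lambda>w. w ^ t) (ball (u y) e)"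
      using power_locally_injective[OF u0[OF y\<Omega>] t_pos] by blast
    obtain T where T: "open T" "q y \<in> T" "f y \<in> {x1, x2} \<or> (\<forall>a\<in>T. \<forall>b\<in>T. a * b \<noteq> 1)"
    proof (cases "f y \<in> {x1, x2}")
      case True
      then show ?thesis using that[of UNIV] by simp
    next
      case False
      have "q y * q y \<noteq> 1"
      proof
        assume "q y * q y = 1"
        then have "q y = 1 \<or> q y = - 1" by (metis power2_eq_1_iff power2_eq_square)
        then have "\<sigma> (f y) = \<sigma> x1 \<or> \<sigma> (f y) = \<sigma> x2" using qJ[OF y\<Omega>] \<sigma>(2,3) by auto
        moreover have "f y \<in> S2 - {x3}" "x1 \<in> S2 - {x3}" "x2 \<in> S2 - {x3}"
          using y\<Omega> f_S2[OF y] in_S2 distinct by (auto simp: \<Omega>_def)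
        ultimately have "f y = x1 \<or> f y = x2"
          using \<sigma>(1) unfolding homeomorphism_def by metis
        then show False using False by blast
      qed
      have "open ((\<lambda>p. fst p * snd p) -` (- {1 :: complex}))"
        by (intro open_vimage continuous_intros open_Compl closed_singleton)
      moreover have "(q y, q y) \<in> (\<lambda>p. fst p * snd p) -` (- {1})" using \<open>q y * q y \<noteq> 1\<close> by simp
      ultimately obtain T1 T2 where "open T1" "open T2" "(q y, q y) \<in> T1 \<times> T2"
        "T1 \<times> T2 \<subseteq> (\<lambda>p. fst p * snd p) -` (- {1 :: complex})" by (rule open_prod_elim)
      then have "\<forall>a\<in>T1 \<inter> T2. \<forall>b\<in>T1 \<inter> T2. a * b \<noteq> 1" by fastforce
      then show ?thesis
        using that[of "T1 \<inter> T2"] \<open>open T1\<close> \<open>open T2\<close> \<open>(q y, q y) \<in> T1 \<times> T2\<close> by blast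
    qed
    define O' where "O' = (\<Omega> \<inter> u -` ball (u y) e) \<inter> (\<Omega> \<inter> q -` T)"
    have "openin (top_of_set \<Omega>) O'" unfolding O'_def
      using T(1) by (intro openin_Int continuous_openin_preimage_gen[OF contu] continuous_openin_preimage_gen[OF contq]) auto
    then have "openin (top_of_set S2) O'" using openin_\<Omega> openin_trans by blast
    moreover have "y \<in> O'" using y\<Omega> e(1) T(2) by (simp add: O'_def)
    ultimately obtain R U V \<phi> \<phi>' \<psi> \<psi>' where c: "power_chart S2 f y (deg y) R U V \<phi> \<phi>' \<psi> \<psi>'" "U \<subseteq> O'"
      using chart[OF y _ _ openin_subtopology_self f_S2[OF y]] by metis
    have uq: "card (u ` M) \<le> card (q ` M)" if M: "M \<subseteq> U - {y}" "finite M" for M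
    proof (rule surj_card_le[where f = "\<lambda>z. the_inv_into (ball (u y) e) (\<lambda>w. w ^ t) z"])
      show "finite (q ` M)" using M by simp
      have "the_inv_into (ball (u y) e) (\<lambda>w. w ^ t) (q a) = u a" if "a \<in> M" for a
      proof -
        have "a \<in> \<Omega>" "u a \<in> ball (u y) e" using that M(1) c(2) by (auto simp: O'_def)
        then show ?thesis using the_inv_into_f_f[OF e(2)] u by metis
      qed
      then show "u ` M \<subseteq> (\<lambda>z. the_inv_into (ball (u y) e) (\<lambda>w. w ^ t) z) ` q ` M" by force
    qed
    have qM: "\<exists>q1 q2. q1 * q2 = 1 \<and> q ` M \<subseteq> {q1, q2}" if "M \<subseteq> \<Omega>" "\<And>a. a \<in> M \<Longrightarrow> f a = x" for M x
    proof -
      obtain q1 q2 where q12: "q1 * q2 = 1" "\<And>z. z \<noteq> 0 \<Longrightarrow> (z + 1 / z) / 2 = \<sigma> x \<longleftrightarrow> z = q1 \<or> z = q2"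
        using joukowski_preimage[of "\<sigma> x"] by blast
      have "q a \<in> {q1, q2}" if a: "a \<in> M" for a
      proof -
        have "a \<in> \<Omega>" "f a = x" using a \<open>M \<subseteq> \<Omega>\<close> \<open>\<And>a. a \<in> M \<Longrightarrow> f a = x\<close> by blast+
        then show ?thesis using q12(2)[of "q a"] qJ[of a] q0[of a] by simp
      qed
      then show ?thesis using q12(1) by blast
    qed
    show ?thesis
    proof (cases "f y \<in> {x1, x2}")
      case True
      have "deg y \<le> 2 * N"
      proof (rule near[OF c(1)])
        fix M x assume M: "M \<subseteq> U - {y}" "finite M" "M \<subseteq> \<Omega>" "\<And>a. a \<in> M \<Longrightarrow> f a = x"
        obtain q1 q2 where "q ` M \<subseteq> {q1, q2}" using qM[OF M(3,4)] by blast
        then have "card (q ` M) \<le> card {q1, q2}" by (intro card_mono) auto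
        also have "\<dots> \<le> 2" by (simp add: card_insert_if)
        finally show "card (u ` M) \<le> 2" using uq[OF M(1,2)] by simp
      qed
      then show ?thesis using True by simp
    next
      case False
      have "deg y \<le> 1 * N"
      proof (rule near[OF c(1)])
        fix M x assume M: "M \<subseteq> U - {y}" "finite M" "M \<subseteq> \<Omega>" "\<And>a. a \<in> M \<Longrightarrow> f a = x"
        obtain q1 q2 where q12: "q1 * q2 = 1" "q ` M \<subseteq> {q1, q2}" using qM[OF M(3,4)] by blast
        have "q ` M \<subseteq> T" using M(1) c(2) by (auto simp: O'_def)
        then have "\<not> (q1 \<in> q ` M \<and> q2 \<in> q ` M)" using T(3) False q12(1) by blast
        then have "q ` M \<subseteq> {q1} \<or> q ` M \<subseteq> {q2}" using q12(2) by blast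
        then have "card (q ` M) \<le> 1"
          by (metis card.empty card_1_singleton_iff card_mono finite.emptyI finite_insert is_singletonI is_singleton_altdef)
        then show "card (u ` M) \<le> 1" using uq[OF M(1,2)] by simp
      qed
      then show ?thesis using False \<open>f y \<noteq> x3\<close> by simp
    qed
  qed
  then show ?thesis using that N(1) by blast
qed

end

section \<open>Branching data\<close>

lemma image_mset_mset_set_eq_bij:
  assumes "finite T" "finite S" "image_mset f (mset_set S) = image_mset g (mset_set T)"
  obtains h where "bij_betw h T S" "\<And>x. x \<in> T \<Longrightarrow> f (h x) = g x"
proof -
  have "\<exists>h. bij_betw h T S \<and> (\<forall>x\<in>T. f (h x) = g x)"
    using assms
  proof (induction T arbitrary: S rule: finite_induct)
    case empty
    then have "S = {}" by (simp add: mset_set_empty_iff)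
    then show ?case by (simp add: bij_betw_def)
  next
    case (insert x T)
    have "g x \<in># image_mset f (mset_set S)" unfolding insert.prems(2) using insert.hyps by simp
    then obtain s where s: "s \<in> S" "f s = g x" using insert.prems(1) by auto
    then have "mset_set S = add_mset s (mset_set (S - {s}))"
      using insert.prems(1) by (simp add: mset_set.remove)
    then have "image_mset f (mset_set (S - {s})) = image_mset g (mset_set T)"
      using insert.prems(2) insert.hyps s(2) by simp
    from insert.IH[OF _ this] insert.prems(1)
    obtain h where h: "bij_betw h T (S - {s})" "\<And>y. y \<in> T \<Longrightarrow> f (h y) = g y" by auto
    have "bij_betw (h(x := s)) T (S - {s})"
      using h(1) insert.hyps(2) by (subst bij_betw_cong[of _ _ h]) auto
    moreover have "bij_betw (h(x := s)) {x} {s}" by simp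
    ultimately have "bij_betw (h(x := s)) (T \<union> {x}) (S - {s} \<union> {s})"
      by (rule bij_betw_combine) simp
    moreover have "T \<union> {x} = insert x T" "S - {s} \<union> {s} = S" using s by auto
    ultimately have "bij_betw (h(x := s)) (insert x T) S" by simp
    moreover have "\<forall>y\<in>insert x T. f ((h(x := s)) y) = g y" using h(2) s(2) insert.hyps(2) by auto
    ultimately show ?case by blast
  qed
  then show ?thesis using that by blast
qed

text \<open>
  A partition of \<open>c * s\<close> into parts that are multiples of \<open>c\<close> has at most \<open>s\<close> parts.
\<close>
lemma length_le_if_parts_ge:
  fixes a :: "nat \<Rightarrow> nat"
  assumes "sum_mset {# c * a l. l \<in># mset_set {1..m} #} = c * s" "c \<ge> 1" "\<And>l. l \<in> {1..m} \<Longrightarrow> a l \<ge> 1"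
  shows "m \<le> s"
proof -
  have "c * (\<Sum>l=1..m. a l) = c * s"
    using assms(1) by (simp add: sum_unfold_sum_mset[symmetric] sum_distrib_left)
  then have "(\<Sum>l=1..m. a l) = s" using assms(2) by simp
  moreover have "(\<Sum>l=1..m. 1) \<le> (\<Sum>l=1..m. a l)" by (intro sum_mono assms(3))
  ultimately show ?thesis by simp
qed

theorem corollary1p2:
  fixes d' t n :: nat
    and r :: "nat \<Rightarrow> nat"
    and a :: "nat \<Rightarrow> nat \<Rightarrow> nat"
    and A :: "nat \<Rightarrow> nat multiset"
  assumes "d' \<ge> 2" and "t \<ge> 2" and "n \<ge> 3" and "t dvd d'"
    and "\<forall>k\<in>{1..n}. nontrivial_partition (2 * d') (A k)"
    and "\<forall>k\<in>{1..n}. \<forall>l\<in>{1..r k}. a k l \<ge> 1"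
    and "A 1 = {# 2 * a 1 l. l \<in># mset_set {1..r 1} #}"
    and "A 2 = {# 2 * a 2 l. l \<in># mset_set {1..r 2} #}"
    and "A 3 = {# t * a 3 l. l \<in># mset_set {1..r 3} #}"
    and "\<forall>k\<in>{4..n}. A k = {# a k l. l \<in># mset_set {1..r k} #}"
    and "(\<Sum>k=1..n. r k) = 2 * (n - 2) * d' + 2"
    and "\<exists>f. branched_cover S2 S2 f \<and> has_cover_degree S2 S2 f (2 * d') \<and>
             branching_data S2 S2 f = {# A k. k \<in># mset_set {1..n} #}"
  shows "(\<forall>i\<in>{1..n}. \<forall>j\<in>{1..r i}. a i j \<le> d' div t) \<and>
         (n \<ge> 4 \<longrightarrow> (\<forall>i\<in>{4..n}. r i > 2 * t))"
proof -
  obtain f where f: "branched_cover S2 S2 f" "has_cover_degree S2 S2 f (2 * d')"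
    "branching_data S2 S2 f = {# A k. k \<in># mset_set {1..n} #}"
    using assms(12) by blast
  define Br where "Br = branch_points S2 S2 f"
  have data: "image_mset (fibre_partition S2 S2 f) (mset_set Br) = image_mset A (mset_set {1..n})"
    using f(3) by (simp add: branching_data_def Br_def)
  have finBr: "finite Br"
  proof (rule ccontr)
    assume "infinite Br"
    then have "image_mset A (mset_set {1..n}) = {#}" using data by simp
    then show False using assms(3) by (simp add: mset_set_empty_iff)
  qed
  \<comment> \<open>The branching data is a multiset; \<open>x k\<close> is a branch point whose partition is \<open>A k\<close>.\<close>
  obtain x where x: "bij_betw x {1..n} Br" "\<And>k. k \<in> {1..n} \<Longrightarrow> fibre_partition S2 S2 f (x k) = A k"
    using image_mset_mset_set_eq_bij[OF _ finBr data] by blast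
  have xS2: "x k \<in> S2" if "k \<in> {1..n}" for k
  proof -
    have "x k \<in> Br" using x(1) that by (rule bij_betwE[rule_format])
    then show ?thesis unfolding Br_def branch_points_def by blast
  qed
  have xinj: "x k = x l \<longleftrightarrow> k = l" if "k \<in> {1..n}" "l \<in> {1..n}" for k l
    using x(1) that by (meson bij_betw_imp_inj_on inj_on_eq_iff)
  have finfib: "finite {y \<in> S2. f y = x k}" if k: "k \<in> {1..n}" for k
  proof (rule ccontr)
    assume "infinite {y \<in> S2. f y = x k}"
    then have "A k = {#}" using x(2)[OF k] by (simp add: fibre_partition_def)
    then show False using bspec[OF assms(5) k] by (simp add: nontrivial_partition_def)
  qed
  have set_A: "set_mset (A k) = local_degree S2 S2 f ` {y \<in> S2. f y = x k}" if k: "k \<in> {1..n}" for k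
    using x(2)[OF k] finfib[OF k] by (simp add: fibre_partition_def flip: x(2)[OF k])
  have n: "1 \<in> {1..n}" "2 \<in> {1..n}" "3 \<in> {1..n}" using assms(3) by auto
  interpret dihedral_branching f "2 * d'" t "x 1" "x 2" "x 3"
  proof
    show "branched_cover S2 S2 f" "has_cover_degree S2 S2 f (2 * d')" by fact+
    show "finite (branch_points S2 S2 f)" using finBr by (simp add: Br_def)
    show "x 1 \<in> S2" "x 2 \<in> S2" "x 3 \<in> S2" using xS2 n by blast+
    show "x 1 \<noteq> x 2" "x 1 \<noteq> x 3" "x 2 \<noteq> x 3" using xinj n by simp_all
    show "finite {y \<in> S2. f y = z}" if "z \<in> {x 1, x 2, x 3}" for z using finfib n that by blast
    show "2 dvd local_degree S2 S2 f y" if y: "y \<in> S2" "f y \<in> {x 1, x 2}" for y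
    proof -
      have "local_degree S2 S2 f y \<in># A 1 \<or> local_degree S2 S2 f y \<in># A 2"
        using set_A[OF n(1)] set_A[OF n(2)] y by blast
      then show ?thesis using assms(7,8) by auto
    qed
    show "t dvd local_degree S2 S2 f y" if y: "y \<in> S2" "f y = x 3" for y
    proof -
      have "local_degree S2 S2 f y \<in># A 3" using set_A[OF n(3)] y by blast
      then show ?thesis using assms(9) by auto
    qed
    show "t \<ge> 1" using assms(2) by simp
  qed
  obtain N where N: "2 * t * N = 2 * d'"
    "\<And>y. y \<in> S2 \<Longrightarrow> deg y \<le> (if f y \<in> {x 1, x 2} then 2 else if f y = x 3 then t else 1) * N"
    using local_degree_bound by blast
  have d': "d' = t * N" using N(1) by simp
  then have Nd: "d' div t = N" using assms(2) by simp
  have part_le: "b \<le> (if k \<in> {1, 2} then 2 else if k = 3 then t else 1) * N" if k: "k \<in> {1..n}" "b \<in># A k" for k b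
  proof -
    obtain y where "y \<in> S2" "f y = x k" "b = deg y" using k(2) set_A[OF k(1)] by blast
    then show ?thesis using N(2)[of y] xinj[OF k(1)] n by auto
  qed
  have a_le: "a i j \<le> N" if i: "i \<in> {1..n}" "j \<in> {1..r i}" for i j
  proof -
    consider "i = 1" | "i = 2" | "i = 3" | "i \<in> {4..n}" using i(1) by force
    then show ?thesis
    proof cases
      case 1
      then have "2 * a i j \<in># A 1" using assms(7) i(2) by simp
      then show ?thesis using part_le[OF n(1)] by fastforce
    next
      case 2
      then have "2 * a i j \<in># A 2" using assms(8) i(2) by simp
      then show ?thesis using part_le[OF n(2)] by fastforce
    next
      case 3
      then have "t * a i j \<in># A 3" using assms(9) i(2) by auto
      then have "t * a i j \<le> t * N" using part_le[OF n(3)] by fastforce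
      then show ?thesis using assms(2) by simp
    next
      case 4
      then have "a i j \<in># A i" using assms(10) i(2) by simp
      then show ?thesis using part_le[OF i(1)] 4 by fastforce
    qed
  qed
  have "r i > 2 * t" if i: "i \<in> {4..n}" for i
  proof -
    have sumA: "sum_mset (A k) = 2 * d'" if "k \<in> {1..n}" for k
      using bspec[OF assms(5) that] by (simp add: nontrivial_partition_def is_partition_def)
    have "i \<in> {1..n}" using i by simp
    from bspec[OF assms(5) this] obtain b where b: "b \<in># A i" "b > 1"
      unfolding nontrivial_partition_def by blast
    then have "N \<ge> 2" using part_le[OF \<open>i \<in> {1..n}\<close> b(1)] i by (simp split: if_splits)
    have r1: "r 1 \<le> d'"
      by (rule length_le_if_parts_ge[of 2 "a 1"]) (use sumA[OF n(1)] bspec[OF assms(6) n(1)] assms(7) in simp_all)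
    have r2: "r 2 \<le> d'"
      by (rule length_le_if_parts_ge[of 2 "a 2"]) (use sumA[OF n(2)] bspec[OF assms(6) n(2)] assms(8) in simp_all)
    have r3: "r 3 \<le> 2 * N"
      by (rule length_le_if_parts_ge[of t "a 3"]) (use sumA[OF n(3)] bspec[OF assms(6) n(3)] assms(2,9) d' in simp_all)
    have rk: "r k \<le> 2 * d'" if k: "k \<in> {4..n}" for k
    proof -
      have k': "k \<in> {1..n}" using k by simp
      show ?thesis
        by (rule length_le_if_parts_ge[of 1 "a k"])
           (use sumA[OF k'] bspec[OF assms(6) k'] bspec[OF assms(10) k] in simp_all)
    qed
    have split: "{1..n} = {1, 2, 3} \<union> {4..n}" using assms(3) by auto
    have "(\<Sum>k=1..n. r k) = r 1 + r 2 + r 3 + (\<Sum>k\<in>{4..n}. r k)"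
      unfolding split by (subst sum.union_disjoint) auto
    also have "(\<Sum>k\<in>{4..n}. r k) = r i + (\<Sum>k\<in>{4..n} - {i}. r k)"
      using i by (intro sum.remove) auto
    also have "(\<Sum>k\<in>{4..n} - {i}. r k) \<le> of_nat (card ({4..n} - {i})) * (2 * d')"
      using rk by (intro sum_bounded_above) auto
    also have "card ({4..n} - {i}) = n - 4" using i by simp
    finally have "2 * (n - 2) * d' + 2 \<le> d' + d' + 2 * N + (r i + (n - 4) * (2 * d'))"
      using assms(11) r1 r2 r3 by simp
    moreover obtain m where "n = m + 4" using i by (metis atLeastAtMost_iff le_Suc_ex le_trans add.commute)
    ultimately have "2 * d' + 2 \<le> 2 * N + r i" by (simp add: algebra_simps)
    then have "2 * (t * N) + 2 \<le> 2 * N + r i" by (simp add: d')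
    \<comment> \<open>With \<open>t = t0 + 2\<close> and \<open>N = N0 + 2\<close> the truncated subtractions disappear:
      \<open>(t - 1) * (N - 1) \<ge> 1\<close> is what turns this bound into \<open>r i > 2 * t\<close>.\<close>
    moreover obtain t0 N0 where "t = t0 + 2" "N = N0 + 2"
      using assms(2) \<open>N \<ge> 2\<close> by (metis add.commute le_Suc_ex)
    ultimately show ?thesis by (simp add: algebra_simps)
  qed
  then show ?thesis using a_le Nd by simp
qed

end
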